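(* Let $k$ be a real number with $0<|k|<1/4$. If the real parameter $a$ is sufficiently small (that is, if $|a|<a_0$ for some $a_0=a_0(k)>0$), then the curve $\mathcal{C}^0_{\mathbb{R}}$ is a trapped attractor for the map $f_a$ on the real projective plane $\mathbb{P}^2(\mathbb{R})$.
   Context: For $k\in\mathbb{R}$, $k\neq0,1$, let $$\Phi(x,y,z)=\Phi_k(x,y,z)=x^2y^2-(x^2+y^2)z^2+kz^4,$$ and let $\mathcal{C}_{\mathbb{R}}\subset\mathbb{P}^2(\mathbb{R})$ be the real Cassini quartic $\Phi=0$. It has singular points (nodes) at $(1:0:0)$ and $(0:1:0)$. Let $\mathcal{C}^0_{\mathbb{R}}$ be the connected component of $\mathcal{C}_{\mathbb{R}}$ which contains $(0:1:0)$. For $a\in\mathbb{R}$ let $f_a$ be the rational map of $\mathbb{P}^2(\mathbb{R})$ given by $(x:y:z)\mapsto(X:Y:Z)$, where $$X=-2xy(x^2+y^2-2kz^2),\qquad Y=y^4-x^4,\qquad Z=-a\,\Phi(x,y,z)+2xy(x^2-y^2).$$ The point $(0:1:0)$ is fixed by $f_a$, the curve $\mathcal{C}_{\mathbb{R}}$ is mapped into itself, and $\mathcal{C}^0_{\mathbb{R}}$ is mapped onto itself. A compact set $A=f(A)$ is a trapped attracting set if it has a compact trapping neighborhood $N$, i.e. a compact neighborhood of $A$ (on which $f$ is defined) with $f(N)\subset N$ and $A=\bigcap_n f^{\circ n}(N)$. It is a trapped attractor if in addition it contains a dense orbit. *)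

theory Defs
  imports "HOL-Analysis.Analysis"
begin

definition proj_rel :: "real \<times> real \<times> real \<Rightarrow> real \<times> real \<times> real \<Rightarrow> bool" where
  "proj_rel u v \<longleftrightarrow> u \<noteq> 0 \<and> v \<noteq> 0 \<and> (\<exists>c. c \<noteq> 0 \<and> v = c *\<^sub>R u)"

lemma proj_rel_refl_iff: "proj_rel v v \<longleftrightarrow> v \<noteq> 0"
  unfolding proj_rel_def by (metis scaleR_one zero_neq_one)

quotient_type proj_plane = "real \<times> real \<times> real" / partial: proj_rel
  morphisms rep_proj proj
proof (rule part_equivpI)
  show "\<exists>v. proj_rel v v"
    using proj_rel_refl_iff[of "(1, 0, 0)"] by (auto simp: zero_prod_def)
  show "symp proj_rel"
  proof (rule sympI)
    fix u v assume "proj_rel u v"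
    then obtain c where "u \<noteq> 0" "v \<noteq> 0" "c \<noteq> 0" "v = c *\<^sub>R u"
      unfolding proj_rel_def by blast
    then have "inverse c \<noteq> 0" "u = inverse c *\<^sub>R v" by auto
    with \<open>u \<noteq> 0\<close> \<open>v \<noteq> 0\<close> show "proj_rel v u" unfolding proj_rel_def by blast
  qed
  show "transp proj_rel"
  proof (rule transpI)
    fix u v w assume "proj_rel u v" "proj_rel v w"
    then obtain c d where "u \<noteq> 0" "w \<noteq> 0" "c \<noteq> 0" "d \<noteq> 0" "v = c *\<^sub>R u" "w = d *\<^sub>R v"
      unfolding proj_rel_def by blast
    then have "d * c \<noteq> 0" "w = (d * c) *\<^sub>R u" by auto
    with \<open>u \<noteq> 0\<close> \<open>w \<noteq> 0\<close> show "proj_rel u w" unfolding proj_rel_def by blast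
  qed
qed

text \<open>
  Quotient topology from the punctured space. As that space is open in the
  ambient one, relative openness of a preimage coincides with openness.
\<close>

instantiation proj_plane :: topological_space
begin

definition open_proj_plane :: "proj_plane set \<Rightarrow> bool" where
  "open_proj_plane U \<longleftrightarrow> open {v. v \<noteq> 0 \<and> proj v \<in> U}"

instance
proof
  have "{v :: real \<times> real \<times> real. v \<noteq> 0 \<and> proj v \<in> UNIV} = - {0}" by auto
  then show "open (UNIV :: proj_plane set)"
    unfolding open_proj_plane_def by (simp add: open_Compl)
next
  fix S T :: "proj_plane set"
  assume "open S" "open T"
  moreover have "{v. v \<noteq> 0 \<and> proj v \<in> S \<inter> T} =
      {v. v \<noteq> 0 \<and> proj v \<in> S} \<inter> {v. v \<noteq> 0 \<and> proj v \<in> T}" by auto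
  ultimately show "open (S \<inter> T)" unfolding open_proj_plane_def by (simp add: open_Int)
next
  fix K :: "proj_plane set set"
  assume "\<forall>S\<in>K. open S"
  moreover have "{v. v \<noteq> 0 \<and> proj v \<in> \<Union>K} = (\<Union>S\<in>K. {v. v \<noteq> 0 \<and> proj v \<in> S})" by auto
  ultimately show "open (\<Union>K)" unfolding open_proj_plane_def by auto
qed

end

fun cassini_poly :: "real \<Rightarrow> real \<times> real \<times> real \<Rightarrow> real" where
  "cassini_poly k (x, y, z) = x^2 * y^2 - (x^2 + y^2) * z^2 + k * z^4"

fun cassini_form :: "real \<Rightarrow> real \<Rightarrow> real \<times> real \<times> real \<Rightarrow> real \<times> real \<times> real" where
  "cassini_form k a (x, y, z) =
     (- 2 * x * y * (x^2 + y^2 - 2 * k * z^2),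
      y^4 - x^4,
      - a * cassini_poly k (x, y, z) + 2 * x * y * (x^2 - y^2))"

lemma cassini_poly_scale: "cassini_poly k (c *\<^sub>R v) = c^4 * cassini_poly k v"
  by (cases v) (simp add: power_mult_distrib algebra_simps eval_nat_numeral)

lemma cassini_form_scale: "cassini_form k a (c *\<^sub>R v) = c^4 *\<^sub>R cassini_form k a v"
  by (cases v) (simp add: power_mult_distrib algebra_simps eval_nat_numeral)

lemma cassini_zero_cong:
  assumes "proj_rel u v"
  shows "cassini_poly k u = 0 \<longleftrightarrow> cassini_poly k v = 0"
    and "cassini_form k a u \<noteq> 0 \<longleftrightarrow> cassini_form k a v \<noteq> 0"
proof -
  obtain c where "c \<noteq> 0" "v = c *\<^sub>R u" using assms unfolding proj_rel_def by blast
  then show "cassini_poly k u = 0 \<longleftrightarrow> cassini_poly k v = 0"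
    and "cassini_form k a u \<noteq> 0 \<longleftrightarrow> cassini_form k a v \<noteq> 0"
    by (simp_all only: cassini_poly_scale cassini_form_scale) simp_all
qed

lift_definition on_cassini :: "real \<Rightarrow> proj_plane \<Rightarrow> bool" is
  "\<lambda>k v. cassini_poly k v = 0"
  by (rule cassini_zero_cong)

definition cassini_curve :: "real \<Rightarrow> proj_plane set" where
  "cassini_curve k = {p. on_cassini k p}"

definition cassini_component :: "real \<Rightarrow> proj_plane set" where
  "cassini_component k = connected_component_set (cassini_curve k) (proj (0, 1, 0))"

text \<open>
  For nonzero \<open>k\<close> the three coordinate forms have no common factor, so the rational
  map is defined exactly where they do not vanish simultaneously.
\<close>

lift_definition cassini_map_defined :: "real \<Rightarrow> real \<Rightarrow> proj_plane \<Rightarrow> bool" is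
  "\<lambda>k a v. cassini_form k a v \<noteq> 0"
  by (rule cassini_zero_cong)

definition cassini_domain :: "real \<Rightarrow> real \<Rightarrow> proj_plane set" where
  "cassini_domain k a = {p. cassini_map_defined k a p}"

text \<open>
  The value at points outside \<open>cassini_domain k a\<close> is arbitrary.
\<close>

lift_definition cassini_map :: "real \<Rightarrow> real \<Rightarrow> proj_plane \<Rightarrow> proj_plane" is
  "\<lambda>k a v. if cassini_form k a v = 0 then (0, 1, 0) else cassini_form k a v"
proof -
  fix k a :: real and u v assume "proj_rel u v"
  then obtain c where c: "c \<noteq> 0" "v = c *\<^sub>R u" unfolding proj_rel_def by blast
  have "proj_rel (0, 1, 0) (0, 1, 0)" by (simp add: proj_rel_refl_iff zero_prod_def)
  moreover have "proj_rel (cassini_form k a u) (c^4 *\<^sub>R cassini_form k a u)"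
    if "cassini_form k a u \<noteq> 0"
    unfolding proj_rel_def using that c(1) by (intro conjI exI[of _ "c^4"]) auto
  ultimately show "proj_rel
      (if cassini_form k a u = 0 then (0, 1, 0) else cassini_form k a u)
      (if cassini_form k a v = 0 then (0, 1, 0) else cassini_form k a v)"
    using c by (simp add: cassini_form_scale)
qed

lemma proj_eq_iff: "u \<noteq> 0 \<Longrightarrow> v \<noteq> 0 \<Longrightarrow> proj u = proj v \<longleftrightarrow> (\<exists>c. c \<noteq> 0 \<and> v = c *\<^sub>R u)"
  using Quotient_rel[OF Quotient_proj_plane, of u v]
  by (auto simp: proj_rel_refl_iff proj_rel_def)

lemma proj_in_cassini_curve_iff:
  "v \<noteq> 0 \<Longrightarrow> proj v \<in> cassini_curve k \<longleftrightarrow> cassini_poly k v = 0"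
  by (simp add: cassini_curve_def on_cassini.abs_eq proj_rel_refl_iff)

lemma proj_in_cassini_domain_iff:
  "v \<noteq> 0 \<Longrightarrow> proj v \<in> cassini_domain k a \<longleftrightarrow> cassini_form k a v \<noteq> 0"
  by (simp add: cassini_domain_def cassini_map_defined.abs_eq proj_rel_refl_iff)

lemma cassini_map_proj:
  "v \<noteq> 0 \<Longrightarrow> cassini_form k a v \<noteq> 0 \<Longrightarrow> cassini_map k a (proj v) = proj (cassini_form k a v)"
  by (simp add: cassini_map.abs_eq proj_rel_refl_iff)

text \<open>
  In the following, \<open>f\<close> is a partial map with domain \<open>D\<close>; the condition
  \<open>N \<subseteq> D\<close> together with invariance of \<open>N\<close> makes all iterates on \<open>N\<close> meaningful.
\<close>

definition compact_trapping_neighborhood ::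
  "'a::topological_space set \<Rightarrow> ('a \<Rightarrow> 'a) \<Rightarrow> 'a set \<Rightarrow> 'a set \<Rightarrow> bool" where
  "compact_trapping_neighborhood D f A N \<longleftrightarrow>
     compact N \<and> A \<subseteq> interior N \<and> N \<subseteq> D \<and> f ` N \<subseteq> N \<and> A = (\<Inter>n. (f ^^ n) ` N)"

definition trapped_attracting_set ::
  "'a::topological_space set \<Rightarrow> ('a \<Rightarrow> 'a) \<Rightarrow> 'a set \<Rightarrow> bool" where
  "trapped_attracting_set D f A \<longleftrightarrow>
     compact A \<and> A = f ` A \<and> (\<exists>N. compact_trapping_neighborhood D f A N)"

definition trapped_attractor ::
  "'a::topological_space set \<Rightarrow> ('a \<Rightarrow> 'a) \<Rightarrow> 'a set \<Rightarrow> bool" where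
  "trapped_attractor D f A \<longleftrightarrow>
     trapped_attracting_set D f A \<and>
     (\<exists>p\<in>A. range (\<lambda>n. (f ^^ n) p) \<subseteq> A \<and> A \<subseteq> closure (range (\<lambda>n. (f ^^ n) p)))"

end

theory Submission
  imports Defs
begin

text \<open>
  Write \<open>\<Phi>\<close> for the Cassini form and \<open>f\<close> for the map. Two mechanisms are at work, one along the
  curve and one transverse to it.

  Along the curve, put \<open>s = z/y\<close> and \<open>c = z/x\<close>. The curve becomes the Edwards curve
  \<open>s\<^sup>2 + c\<^sup>2 = 1 + k s\<^sup>2 c\<^sup>2\<close>, whose group law is the addition theorem of the Jacobi functions
  \<open>s = sn\<close> and \<open>c = cd\<close> with parameter \<open>k\<close>, and \<open>f\<close> becomes multiplication by \<open>-2\<close>. Hence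
  \<open>\<gamma>(u) = (sn u : cd u : sn u cd u)\<close> is a continuous periodic parametrization of the component
  by the line, and \<open>f(\<gamma>(u)) = \<gamma>(-2 u)\<close> (\<open>cassini_component_uniformization\<close>). It follows that \<open>f\<close>
  maps the component onto itself, and that a dense orbit of multiplication by \<open>-2\<close> modulo the
  period (\<open>dense_orbit_times_minus_two\<close>) yields a dense orbit on the component.

  Transversally, the quotient \<open>|\<Phi>| / (x\<^sup>2 + y\<^sup>2)\<^sup>2\<close> is contracted (\<open>cassini_form_estimates\<close>). For
  \<open>a = 0\<close> there is the identity \<open>\<Phi> \<circ> F = 16 k x\<^sup>2 y\<^sup>2 (x\<^sup>2 - y\<^sup>2)\<^sup>4 \<Phi>\<close> for the map \<open>F = (X, Y, Z)\<close> on
  coordinates; as \<open>Y = (y\<^sup>2 - x\<^sup>2) (x\<^sup>2 + y\<^sup>2)\<close> and \<open>4 x\<^sup>2 y\<^sup>2 \<le> (x\<^sup>2 + y\<^sup>2)\<^sup>2\<close>, the quotient is multiplied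
  by at most \<open>4 |k| < 1\<close>. For general \<open>a\<close> the form \<open>\<Phi> \<circ> F\<close> changes by a multiple of \<open>a \<Phi>\<close>, which
  on the Moebius band \<open>z\<^sup>2 \<le> x\<^sup>2 + y\<^sup>2\<close> raises the factor to at most \<open>4 |k| + 72 |a|\<close>. This is less
  than \<open>1\<close> for small \<open>a\<close>. The band is mapped into itself and lies in the domain of \<open>f\<close>; it
  therefore is a trapping neighborhood. On the intersection of its images \<open>\<Phi>\<close> vanishes, and the
  part of the curve in the band is precisely the component.
\<close>

section \<open>Jacobi functions on the Edwards curve\<close>

text \<open>
  The amplitude is the inverse of the elliptic integral of the first kind with parameter \<open>k\<close>.
  As \<open>|k| < 1/4\<close>, the integrand lies between two positive constants, so the integral is a
  diffeomorphism of the line. Quasi-periodicity and oddness come from those of the integrand.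
\<close>

lemma jacobi_amplitude:
  fixes k :: real
  assumes k: "\<bar>k\<bar> < 1/4"
  obtains am L where "L > 0"
    "\<And>u. (am has_real_derivative sqrt (1 - k * (sin (am u))\<^sup>2)) (at u)"
    "\<And>u. am (u + L) = am u + 2 * pi" "\<And>u. am (- u) = - am u" "surj am"
proof -
  define D where "D \<phi> = sqrt (1 - k * (sin \<phi>)\<^sup>2)" for \<phi>
  have sin2: "(sin \<phi>)\<^sup>2 \<le> 1" for \<phi> :: real
    using abs_sin_le_one by (simp add: abs_square_le_1)
  have ksin: "\<bar>k * (sin \<phi>)\<^sup>2\<bar> \<le> 1/4" for \<phi>
  proof -
    have "\<bar>k\<bar> * (sin \<phi>)\<^sup>2 \<le> 1/4 * 1"
      using k by (intro mult_mono sin2) auto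
    then show ?thesis by (simp add: abs_mult)
  qed
  have D_pos: "D \<phi> > 0" for \<phi>
    using ksin[of \<phi>] by (auto simp: D_def abs_le_iff)
  have D_le: "D \<phi> \<le> 2" for \<phi>
    unfolding D_def using ksin[of \<phi>] by (intro real_le_lsqrt) (auto simp: abs_le_iff)
  have D_cont: "isCont (\<lambda>\<phi>. 1 / D \<phi>) \<phi>" for \<phi>
  proof -
    have "D \<phi> \<noteq> 0" using D_pos[of \<phi>] by simp
    then show ?thesis unfolding D_def by (intro continuous_intros) auto
  qed
  obtain U0 where U0: "\<And>\<phi>. (U0 has_vector_derivative 1 / D \<phi>) (at \<phi>)"
    using einterval_antiderivative[of "-\<infinity>" \<infinity> "\<lambda>\<phi>. 1 / D \<phi>"] D_cont by auto
  define U where "U \<phi> = U0 \<phi> - U0 0" for \<phi>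
  have U: "(U has_real_derivative 1 / D \<phi>) (at \<phi>)" for \<phi>
    using U0[of \<phi>] unfolding U_def
    by (auto intro!: derivative_eq_intros simp: has_real_derivative_iff_has_vector_derivative[symmetric])
  have U_cont: "isCont U \<phi>" for \<phi> using U DERIV_isCont by blast
  have U_less: "U \<phi> < U \<psi>" if "\<phi> < \<psi>" for \<phi> \<psi>
    using that U D_pos by (intro DERIV_pos_imp_increasing[of \<phi> \<psi> U]) (auto intro!: exI)
  have U_inj: "inj U"
    by (rule injI) (metis U_less linorder_neqE_linordered_idom order_less_irrefl)
  \<comment> \<open>The integrand is at least \<open>1/2\<close>, hence the integral is unbounded in both directions.\<close>
  have U_grow: "(\<psi> - \<phi>) / 2 \<le> U \<psi> - U \<phi>" if "\<phi> \<le> \<psi>" for \<phi> \<psi>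
  proof -
    have "U \<phi> - \<phi> / 2 \<le> U \<psi> - \<psi> / 2"
    proof (rule DERIV_nonneg_imp_nondecreasing[OF that])
      fix x
      have "((\<lambda>x. U x - x / 2) has_real_derivative (1 / D x - 1 / 2)) (at x)"
        using U by (auto intro!: derivative_eq_intros)
      moreover have "1 / 2 \<le> 1 / D x" using D_pos[of x] D_le[of x] by (simp add: field_simps)
      ultimately show "\<exists>y. ((\<lambda>x. U x - x / 2) has_real_derivative y) (at x) \<and> 0 \<le> y" by auto
    qed
    then show ?thesis by (simp add: field_simps)
  qed
  have U_0: "U 0 = 0" by (simp add: U_def)
  have U_surj: "\<exists>\<phi>. U \<phi> = u" for u
  proof -
    have "U (- 2 * \<bar>u\<bar>) \<le> u" "u \<le> U (2 * \<bar>u\<bar>)"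
      using U_grow[of "- 2 * \<bar>u\<bar>" 0] U_grow[of 0 "2 * \<bar>u\<bar>"] U_0 by auto
    then show ?thesis
      using IVT[of U "- 2 * \<bar>u\<bar>" u "2 * \<bar>u\<bar>"] U_cont by auto
  qed
  define am where "am = inv U"
  have am_U: "am (U \<phi>) = \<phi>" for \<phi> unfolding am_def by (simp add: U_inj)
  have U_am: "U (am u) = u" for u
    unfolding am_def using U_surj by (metis f_inv_into_f rangeI)
  have am_cont: "isCont am u" for u
    using isCont_inverse_function[of 1 "am u" am U] am_U U_cont U_am by auto
  have am_deriv: "(am has_real_derivative D (am u)) (at u)" for u
    using DERIV_inverse_function[of U "1 / D (am u)" am u "u - 1" "u + 1"]
      U U_am am_cont D_pos[of "am u"] by auto
  have "U (\<phi> + 2 * pi) - U \<phi> = U (0 + 2 * pi) - U 0" for \<phi>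
  proof (rule DERIV_isconst_all[where f = "\<lambda>x. U (x + 2 * pi) - U x"], rule allI)
    fix x
    have "D (x + 2 * pi) = D x" by (simp add: D_def)
    moreover have "((\<lambda>x. U (x + 2 * pi)) has_real_derivative 1 / D (x + 2 * pi)) (at x)"
      using U[of "x + 2 * pi"] DERIV_shift by blast
    ultimately show "((\<lambda>x. U (x + 2 * pi) - U x) has_real_derivative 0) (at x)"
      using U[of x] by (auto intro!: derivative_eq_intros)
  qed
  from this U_0 have U_period: "U (\<phi> + 2 * pi) = U \<phi> + U (2 * pi)" for \<phi>
    by (metis add.commute add_0 diff_add_cancel diff_zero)
  have "U (- \<phi>) + U \<phi> = U (- 0) + U 0" for \<phi>
  proof (rule DERIV_isconst_all[where f = "\<lambda>x. U (- x) + U x"], rule allI)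
    fix x
    have "D (- x) = D x" by (simp add: D_def)
    moreover have "((\<lambda>x. U (- x)) has_real_derivative - (1 / D (- x))) (at x)"
      using U[of "- x"] DERIV_mirror by blast
    ultimately show "((\<lambda>x. U (- x) + U x) has_real_derivative 0) (at x)"
      using U[of x] by (auto intro!: derivative_eq_intros)
  qed
  from this U_0 have U_odd: "U (- \<phi>) = - U \<phi>" for \<phi>
    by (metis add.inverse_neutral add_0 eq_neg_iff_add_eq_0)
  show thesis
  proof (rule that[of "U (2 * pi)" am])
    show "U (2 * pi) > 0" using U_less[of 0 "2 * pi"] U_0 by simp
    show "(am has_real_derivative sqrt (1 - k * (sin (am u))\<^sup>2)) (at u)" for u
      using am_deriv unfolding D_def .
    show "am (u + U (2 * pi)) = am u + 2 * pi" for u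
      by (metis U_am U_period am_U)
    show "am (- u) = - am u" for u by (metis U_am U_odd am_U)
    show "surj am" by (metis am_U surjI)
  qed
qed

text \<open>
  The functions \<open>sn = sin am\<close> and \<open>cd = cn/dn\<close> parametrize the component of the Edwards curve
  in the square \<open>|x|, |y| \<le> 1\<close>. The curve equation is quadratic in \<open>y\<close>, with solution
  \<open>y = cos \<phi> / sqrt (1 - k sin\<^sup>2 \<phi>)\<close> for \<open>x = sin \<phi>\<close>; the speed \<open>\<phi>' = dn\<close> of the amplitude makes
  the derivatives of both coordinates polynomial, and these derivatives are what the
  addition theorem below is proved from.
\<close>

lemma jacobi_sn_cd:
  fixes k :: real
  assumes k: "\<bar>k\<bar> < 1/4"
  obtains sn cd :: "real \<Rightarrow> real" and L where "L > 0"
    "\<And>u. (sn has_real_derivative cd u * (1 - k * (sn u)\<^sup>2)) (at u)"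
    "\<And>u. (cd has_real_derivative - (sn u * (1 - k * (cd u)\<^sup>2))) (at u)"
    "\<And>u. (sn u)\<^sup>2 + (cd u)\<^sup>2 = 1 + k * (sn u)\<^sup>2 * (cd u)\<^sup>2"
    "\<And>u. \<bar>sn u\<bar> \<le> 1" "\<And>u. \<bar>cd u\<bar> \<le> 1" "sn 0 = 0" "cd 0 = 1"
    "\<And>u. sn (u + L) = sn u" "\<And>u. cd (u + L) = cd u"
    "\<And>u. sn (- u) = - sn u" "\<And>u. cd (- u) = cd u"
    "\<And>x y. \<bar>x\<bar> \<le> 1 \<Longrightarrow> x\<^sup>2 + y\<^sup>2 = 1 + k * x\<^sup>2 * y\<^sup>2 \<Longrightarrow> \<exists>u. sn u = x \<and> cd u = y"
proof -
  obtain am L where L: "L > 0"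
    and am: "\<And>u. (am has_real_derivative sqrt (1 - k * (sin (am u))\<^sup>2)) (at u)"
    and per: "\<And>u. am (u + L) = am u + 2 * pi" and odd: "\<And>u. am (- u) = - am u" and surj: "surj am"
    using jacobi_amplitude[OF k] by metis
  define dn where "dn u = sqrt (1 - k * (sin (am u))\<^sup>2)" for u
  define sn where "sn u = sin (am u)" for u
  define cd where "cd u = cos (am u) / dn u" for u
  have pos: "1 - k * x\<^sup>2 > 0" if "\<bar>x\<bar> \<le> 1" for x :: real
  proof -
    have "k * x\<^sup>2 \<le> \<bar>k\<bar> * 1"
      using that by (intro mult_mono) (auto simp: abs_square_le_1)
    then show ?thesis using k by simp
  qed
  have dn_pos: "dn u > 0" for u
    unfolding dn_def using pos[of "sin (am u)"] by simp
  have dn_sq: "(dn u)\<^sup>2 = 1 - k * (sn u)\<^sup>2" for u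
    unfolding dn_def sn_def using pos[of "sin (am u)"] by simp
  have cos_am: "cos (am u) = cd u * dn u" for u
    unfolding cd_def using dn_pos[of u] by simp
  have curve: "(sn u)\<^sup>2 + (cd u)\<^sup>2 = 1 + k * (sn u)\<^sup>2 * (cd u)\<^sup>2" for u
  proof -
    have "(sn u)\<^sup>2 + (cd u)\<^sup>2 * (1 - k * (sn u)\<^sup>2) = 1"
      using sin_cos_squared_add[of "am u"] unfolding dn_sq[symmetric] cos_am
      by (simp add: sn_def power_mult_distrib)
    then show ?thesis by (simp add: algebra_simps)
  qed
  have sn_le: "\<bar>sn u\<bar> \<le> 1" for u unfolding sn_def by (rule abs_sin_le_one)
  have sn_deriv: "(sn has_real_derivative cd u * (1 - k * (sn u)\<^sup>2)) (at u)" for u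
  proof -
    have "((\<lambda>u. sin (am u)) has_real_derivative cos (am u) * dn u) (at u)"
      using am[of u] unfolding dn_def by (auto intro!: derivative_eq_intros)
    then show ?thesis
      unfolding sn_def[abs_def] cos_am dn_sq[of u, unfolded sn_def, symmetric]
      by (simp add: power2_eq_square mult.assoc)
  qed
  have dn_deriv: "(dn has_real_derivative - (k * sn u * cd u * dn u)) (at u)" for u
  proof -
    have "((\<lambda>u. sqrt (1 - k * (sn u)\<^sup>2)) has_real_derivative
        (- (k * (2 * sn u * (cd u * (1 - k * (sn u)\<^sup>2))))) * (inverse (sqrt (1 - k * (sn u)\<^sup>2)) / 2)) (at u)"
      using sn_deriv[of u] pos[OF sn_le[of u]]
      by (auto intro!: derivative_eq_intros)
    moreover have "(\<lambda>u. sqrt (1 - k * (sn u)\<^sup>2)) = dn" by (simp add: dn_def sn_def fun_eq_iff)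
    moreover from this have "sqrt (1 - k * (sn u)\<^sup>2) = dn u" by metis
    moreover have "(- (k * (2 * sn u * (cd u * (dn u)\<^sup>2)))) * (inverse (dn u) / 2) = - (k * sn u * cd u * dn u)"
      using dn_pos[of u] by (simp add: field_simps power2_eq_square)
    ultimately show ?thesis by (simp only: dn_sq)
  qed
  have cd_deriv: "(cd has_real_derivative - (sn u * (1 - k * (cd u)\<^sup>2))) (at u)" for u
  proof -
    have "((\<lambda>u. cos (am u) / dn u) has_real_derivative
        (- (sn u) * dn u * dn u + cos (am u) * (k * sn u * cd u * dn u)) / (dn u * dn u)) (at u)"
      using am[of u] dn_deriv[of u] dn_pos[of u]
      by (auto intro!: derivative_eq_intros simp: dn_def[symmetric] sn_def)
    moreover have "(- (sn u) * dn u * dn u + cos (am u) * (k * sn u * cd u * dn u)) / (dn u * dn u)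
      = - (sn u * (1 - k * (cd u)\<^sup>2))"
      unfolding cos_am using dn_pos[of u] by (simp add: field_simps power2_eq_square)
    ultimately show ?thesis unfolding cd_def[abs_def] by simp
  qed
  have cd_le: "\<bar>cd u\<bar> \<le> 1" for u
  proof -
    have "(1 - (cd u)\<^sup>2) * (dn u)\<^sup>2 = (1 - k) * (sn u)\<^sup>2"
      using curve[of u] dn_sq[of u] by algebra
    then have "(1 - (cd u)\<^sup>2) * (dn u)\<^sup>2 \<ge> 0" using k by simp
    then have "(cd u)\<^sup>2 \<le> 1" using dn_pos[of u] by (simp add: zero_le_mult_iff)
    then show ?thesis by (simp add: abs_square_le_1)
  qed
  have am_0: "am 0 = 0" using odd[of 0] by simp
  show thesis
  proof (rule that[of L sn cd])
    show "\<exists>u. sn u = x \<and> cd u = y" if x: "\<bar>x\<bar> \<le> 1" and c: "x\<^sup>2 + y\<^sup>2 = 1 + k * x\<^sup>2 * y\<^sup>2" for x y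
    proof -
      have sq: "(sqrt (1 - k * x\<^sup>2))\<^sup>2 = 1 - k * x\<^sup>2" using pos[OF x] by simp
      have "(y * sqrt (1 - k * x\<^sup>2))\<^sup>2 + x\<^sup>2 = 1"
        using c unfolding power_mult_distrib sq by (simp add: algebra_simps)
      then obtain \<phi> where "y * sqrt (1 - k * x\<^sup>2) = cos \<phi>" "x = sin \<phi>"
        using sincos_total_2pi by metis
      moreover obtain u where "\<phi> = am u" using surj by blast
      ultimately have "sn u = x" "cd u = y"
        using pos[OF x] by (auto simp: sn_def cd_def dn_def field_simps)
      then show ?thesis by blast
    qed
  qed (use L sn_deriv cd_deriv curve sn_le cd_le in
      \<open>auto simp: sn_def cd_def dn_def per odd am_0\<close>)
qed

lemma edwards_denominators_pos:
  fixes k :: real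
  assumes "\<bar>k\<bar> < 1/4" "\<bar>a\<bar> \<le> 1" "\<bar>b\<bar> \<le> 1" "\<bar>c\<bar> \<le> 1" "\<bar>d\<bar> \<le> 1"
  shows "1 + k * (a * b * c * d) > 0" "1 - k * (a * b * c * d) > 0"
proof -
  have "\<bar>a * b * c * d\<bar> \<le> 1 * 1 * 1 * 1"
    unfolding abs_mult using assms by (intro mult_mono) auto
  then have "\<bar>k * (a * b * c * d)\<bar> \<le> 1/4 * 1"
    unfolding abs_mult[of k] using assms(1) by (intro mult_mono) auto
  then show "1 + k * (a * b * c * d) > 0" "1 - k * (a * b * c * d) > 0" by linarith+
qed

text \<open>
  For \<open>(x, y) = (sn t, cd t)\<close> and \<open>(z, w) = (sn (c - t), cd (c - t))\<close>, the two left-hand sides are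
  the numerators of the derivatives in \<open>t\<close> of the Edwards sum
  \<open>(x w + y z) / (1 + k x y z w)\<close>, \<open>(y w - x z) / (1 - k x y z w)\<close> of the two points.
  They lie in the ideal generated by the two curve equations; \<open>k Q\<close> is the derivative of
  \<open>k x y z w\<close>.
\<close>

lemma edwards_addition_identities:
  fixes k x y z w :: real
  assumes "x\<^sup>2 + y\<^sup>2 = 1 + k * x\<^sup>2 * y\<^sup>2" "z\<^sup>2 + w\<^sup>2 = 1 + k * z\<^sup>2 * w\<^sup>2"
  defines "Q \<equiv> (y\<^sup>2 - x\<^sup>2) * z * w + x * y * (z\<^sup>2 - w\<^sup>2)"
  shows "k * (y * w * (z\<^sup>2 - x\<^sup>2) + x * z * (y\<^sup>2 - w\<^sup>2)) * (1 + k * ((x * y) * (z * w)))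
      - (x * w + y * z) * (0 + k * Q) = 0"
    and "k * (y * z * (x\<^sup>2 - w\<^sup>2) + x * w * (y\<^sup>2 - z\<^sup>2)) * (1 - k * ((x * y) * (z * w)))
      - (y * w - x * z) * (0 - k * Q) = 0"
proof -
  have "k * (y * w * (z\<^sup>2 - x\<^sup>2) + x * z * (y\<^sup>2 - w\<^sup>2)) * (1 + k * ((x * y) * (z * w)))
      - (x * w + y * z) * (0 + k * Q)
    = k * ((x\<^sup>2 + y\<^sup>2 - (1 + k * x\<^sup>2 * y\<^sup>2)) * (x * z * w\<^sup>2 - y * w * z\<^sup>2)
    + (z\<^sup>2 + w\<^sup>2 - (1 + k * z\<^sup>2 * w\<^sup>2)) * (y * w * x\<^sup>2 - x * z * y\<^sup>2))"
    unfolding Q_def by (simp add: field_simps power2_eq_square)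
  then show "k * (y * w * (z\<^sup>2 - x\<^sup>2) + x * z * (y\<^sup>2 - w\<^sup>2)) * (1 + k * ((x * y) * (z * w)))
      - (x * w + y * z) * (0 + k * Q) = 0" using assms(1,2) by simp
  have "k * (y * z * (x\<^sup>2 - w\<^sup>2) + x * w * (y\<^sup>2 - z\<^sup>2)) * (1 - k * ((x * y) * (z * w)))
      - (y * w - x * z) * (0 - k * Q)
    = k * ((x\<^sup>2 + y\<^sup>2 - (1 + k * x\<^sup>2 * y\<^sup>2)) * (y * z * w\<^sup>2 + x * w * z\<^sup>2)
    - (z\<^sup>2 + w\<^sup>2 - (1 + k * z\<^sup>2 * w\<^sup>2)) * (x * w * y\<^sup>2 + y * z * x\<^sup>2))"
    unfolding Q_def by (simp add: field_simps power2_eq_square)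
  then show "k * (y * z * (x\<^sup>2 - w\<^sup>2) + x * w * (y\<^sup>2 - z\<^sup>2)) * (1 - k * ((x * y) * (z * w)))
      - (y * w - x * z) * (0 - k * Q) = 0" using assms(1,2) by simp
qed

text \<open>
  Addition theorem, in Euler's manner: the Edwards sum of the points with parameters \<open>t\<close> and
  \<open>2 u - t\<close> does not depend on \<open>t\<close>. At \<open>t = 0\<close> it is the point with parameter \<open>2 u\<close>, at \<open>t = u\<close>
  it is the double of the point with parameter \<open>u\<close>.
\<close>

lemma edwards_doubling:
  fixes k :: real and sn cd :: "real \<Rightarrow> real"
  assumes k: "\<bar>k\<bar> < 1/4"
    and sn: "\<And>u. (sn has_real_derivative cd u * (1 - k * (sn u)\<^sup>2)) (at u)"
    and cd: "\<And>u. (cd has_real_derivative - (sn u * (1 - k * (cd u)\<^sup>2))) (at u)"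
    and curve: "\<And>u. (sn u)\<^sup>2 + (cd u)\<^sup>2 = 1 + k * (sn u)\<^sup>2 * (cd u)\<^sup>2"
    and le: "\<And>u. \<bar>sn u\<bar> \<le> 1" "\<And>u. \<bar>cd u\<bar> \<le> 1" and at_0: "sn 0 = 0" "cd 0 = 1"
  shows "sn (2 * u) = 2 * sn u * cd u / (1 + k * (sn u)\<^sup>2 * (cd u)\<^sup>2)"
    and "cd (2 * u) = ((cd u)\<^sup>2 - (sn u)\<^sup>2) / (1 - k * (sn u)\<^sup>2 * (cd u)\<^sup>2)"
proof -
  define N M P where
    "N t = sn t * cd (2 * u - t) + cd t * sn (2 * u - t)" and
    "M t = cd t * cd (2 * u - t) - sn t * sn (2 * u - t)" and
    "P t = (sn t * cd t) * (sn (2 * u - t) * cd (2 * u - t))" for t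
  note pos = edwards_denominators_pos[OF k le(1) le(2) le(1) le(2)]
  have refl: "((\<lambda>t. 2 * u - t) has_real_derivative - 1) (at t)" for t
    by (auto intro!: derivative_eq_intros)
  note sn' = DERIV_chain2[OF sn refl] and cd' = DERIV_chain2[OF cd refl]
  \<comment> \<open>In the derivative of \<open>P\<close> all terms with \<open>k\<close> cancel.\<close>
  have dP: "(P has_real_derivative
      ((cd t)\<^sup>2 - (sn t)\<^sup>2) * sn (2 * u - t) * cd (2 * u - t)
        + sn t * cd t * ((sn (2 * u - t))\<^sup>2 - (cd (2 * u - t))\<^sup>2)) (at t)" for t
    unfolding P_def[abs_def]
    by (rule DERIV_cong[OF DERIV_mult[OF DERIV_mult[OF sn cd] DERIV_mult[OF sn' cd']]])
       (simp add: algebra_simps power2_eq_square)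
  have dN: "(N has_real_derivative
      k * (cd t * cd (2 * u - t) * ((sn (2 * u - t))\<^sup>2 - (sn t)\<^sup>2)
         + sn t * sn (2 * u - t) * ((cd t)\<^sup>2 - (cd (2 * u - t))\<^sup>2))) (at t)" for t
    unfolding N_def[abs_def]
    by (rule DERIV_cong[OF DERIV_add[OF DERIV_mult[OF sn cd'] DERIV_mult[OF cd sn']]])
       (simp add: algebra_simps power2_eq_square)
  have dM: "(M has_real_derivative
      k * (cd t * sn (2 * u - t) * ((sn t)\<^sup>2 - (cd (2 * u - t))\<^sup>2)
         + sn t * cd (2 * u - t) * ((cd t)\<^sup>2 - (sn (2 * u - t))\<^sup>2))) (at t)" for t
    unfolding M_def[abs_def]
    by (rule DERIV_cong[OF DERIV_diff[OF DERIV_mult[OF cd cd'] DERIV_mult[OF sn sn']]])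
       (simp add: algebra_simps power2_eq_square)
  have "N 0 / (1 + k * P 0) = N u / (1 + k * P u)"
  proof (rule DERIV_isconst_all[where f = "\<lambda>t. N t / (1 + k * P t)"], rule allI)
    fix t
    have nz: "1 + k * P t \<noteq> 0" using pos(1)[of t t "2 * u - t" "2 * u - t"] by (simp add: P_def mult.assoc)
    show "((\<lambda>t. N t / (1 + k * P t)) has_real_derivative 0) (at t)"
      by (rule DERIV_cong[OF DERIV_divide[OF dN DERIV_add[OF DERIV_const DERIV_cmult[OF dP]] nz]])
        (simp only: N_def P_def edwards_addition_identities(1)[OF curve[of t] curve[of "2 * u - t"]]
        div_0)
  qed
  then show "sn (2 * u) = 2 * sn u * cd u / (1 + k * (sn u)\<^sup>2 * (cd u)\<^sup>2)"
    by (simp add: N_def P_def at_0 power2_eq_square algebra_simps)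
  have "M 0 / (1 - k * P 0) = M u / (1 - k * P u)"
  proof (rule DERIV_isconst_all[where f = "\<lambda>t. M t / (1 - k * P t)"], rule allI)
    fix t
    have nz: "1 - k * P t \<noteq> 0" using pos(2)[of t t "2 * u - t" "2 * u - t"] by (simp add: P_def mult.assoc)
    show "((\<lambda>t. M t / (1 - k * P t)) has_real_derivative 0) (at t)"
      by (rule DERIV_cong[OF DERIV_divide[OF dM DERIV_diff[OF DERIV_const DERIV_cmult[OF dP]] nz]])
        (simp only: M_def P_def edwards_addition_identities(2)[OF curve[of t] curve[of "2 * u - t"]]
        div_0)
  qed
  then show "cd (2 * u) = ((cd u)\<^sup>2 - (sn u)\<^sup>2) / (1 - k * (sn u)\<^sup>2 * (cd u)\<^sup>2)"
    by (simp add: M_def P_def at_0 power2_eq_square algebra_simps)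
qed

section \<open>A dense orbit of multiplication by minus two\<close>

text \<open>
  Baire category: for each rational interval, the points of the line with some iterate in that
  interval modulo \<open>L\<close> form an open set, and the set is dense because multiplication by
  \<open>(- 2) ^ n\<close> eventually stretches every interval beyond the period \<open>L\<close>.
\<close>

lemma dense_orbit_times_minus_two:
  fixes L :: real
  assumes L: "L > 0"
  obtains t where "\<And>p q. p < q \<Longrightarrow> \<exists>n m. p < (- 2) ^ n * t + of_int m * L \<and> (- 2) ^ n * t + of_int m * L < q"
proof -
  define G where "G = (\<lambda>(p, q). \<Union>n. \<Union>m. {t. p < (- 2) ^ n * t + of_int m * L \<and> (- 2) ^ n * t + of_int m * L < q})"
  define I where "I = {(p, q) \<in> \<rat> \<times> \<rat>. p < (q :: real)}"
  have G_open: "open (G pq)" for pq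
    unfolding G_def by (cases pq) (auto intro!: open_UN open_Collect_conj open_Collect_less continuous_intros)
  have G_dense: "t \<in> closure (G (p, q))" if "p < q" for p q t
    unfolding closure_approachable
  proof (intro allI impI)
    fix e :: real assume "e > 0"
    then obtain n where n: "L / e < 2 ^ n" using real_arch_pow[of 2 "L / e"] by auto
    define w where "w = (p + q) / 2"
    \<comment> \<open>Among the preimages of the points \<open>w - m L\<close> one is closer to \<open>t\<close> than \<open>L / 2 ^ n < e\<close>.\<close>
    define m where "m = \<lfloor>(w - (- 2) ^ n * t) / L\<rfloor>"
    define t' where "t' = (w - of_int m * L) / (- 2) ^ n"
    have t': "(- 2) ^ n * t' = w - of_int m * L" unfolding t'_def by simp
    have "of_int m \<le> (w - (- 2) ^ n * t) / L" "(w - (- 2) ^ n * t) / L < of_int m + 1"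
      unfolding m_def by linarith+
    then have "of_int m * L \<le> w - (- 2) ^ n * t" "w - (- 2) ^ n * t < of_int m * L + L"
      using L by (simp_all add: field_simps)
    then have "\<bar>(- 2) ^ n * t' - (- 2) ^ n * t\<bar> < L" unfolding t' by linarith
    then have "2 ^ n * \<bar>t' - t\<bar> < L"
      by (simp add: right_diff_distrib[symmetric] abs_mult power_abs)
    also have "L < 2 ^ n * e" using n \<open>e > 0\<close> by (simp add: field_simps)
    finally have "dist t' t < e" by (simp add: dist_real_def)
    moreover have "t' \<in> G (p, q)"
      unfolding G_def using that by (auto intro!: exI[of _ n] exI[of _ m] simp: t' w_def)
    ultimately show "\<exists>y\<in>G (p, q). dist y t < e" by blast
  qed
  have "UNIV \<subseteq> closure (\<Inter>(G ` I))"
  proof (rule Baire)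
    show "countable (G ` I)"
      unfolding I_def by (intro countable_image countable_subset[OF _ countable_SIGMA[OF countable_rat countable_rat]]) auto
    show "openin (top_of_set UNIV) T \<and> UNIV \<subseteq> closure T" if "T \<in> G ` I" for T
      using that G_open G_dense unfolding I_def by (auto simp: subtopology_UNIV)
  qed simp
  then obtain t where t: "t \<in> \<Inter>(G ` I)" by (metis UNIV_I closure_empty empty_iff equals0I subset_empty)
  show thesis
  proof (rule that)
    fix p q :: real assume "p < q"
    then obtain p' where p': "p' \<in> \<rat>" "p < p'" "p' < q" using Rats_dense_in_real by blast
    then obtain q' where q': "q' \<in> \<rat>" "p' < q'" "q' < q" using Rats_dense_in_real by blast
    have "t \<in> G (p', q')" using t p' q' unfolding I_def by auto
    then obtain n m where "p' < (- 2) ^ n * t + of_int m * L" "(- 2) ^ n * t + of_int m * L < q'"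
      unfolding G_def by auto
    then show "\<exists>n m. p < (- 2) ^ n * t + of_int m * L \<and> (- 2) ^ n * t + of_int m * L < q"
      using p' q' by (intro exI[of _ n] exI[of _ m]) linarith
  qed
qed

section \<open>The projective plane as a quotient space\<close>

lemma proj_cases:
  obtains x y z where "p = proj (x, y, z)" "(x, y, z) \<noteq> 0"
proof -
  have "proj (rep_proj p) = p" "rep_proj p \<noteq> 0"
    using Quotient_abs_rep[OF Quotient_proj_plane, of p] Quotient_rep_reflp[OF Quotient_proj_plane, of p]
    by (simp_all add: proj_rel_refl_iff)
  then show thesis using that by (metis prod_cases3)
qed

lemma proj_scale: "v \<noteq> 0 \<Longrightarrow> c \<noteq> 0 \<Longrightarrow> proj (c *\<^sub>R v) = proj v"
  by (metis proj_eq_iff scaleR_eq_0_iff)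

lemma continuous_on_proj: "continuous_on (- {0}) proj"
  unfolding continuous_on_open_vimage[OF open_Compl[OF closed_singleton]]
proof (intro allI impI)
  fix U :: "proj_plane set" assume "open U"
  moreover have "{v. v \<noteq> 0 \<and> proj v \<in> U} = proj -` U \<inter> - {0}" by auto
  ultimately show "open (proj -` U \<inter> - {0})" unfolding open_proj_plane_def by simp
qed

lemma proj_in_image_iff:
  assumes "v \<noteq> 0" "\<And>c u. c \<noteq> 0 \<Longrightarrow> P u \<Longrightarrow> P (c *\<^sub>R u)"
  shows "proj v \<in> proj ` {u. u \<noteq> 0 \<and> P u} \<longleftrightarrow> P v"
proof
  assume "proj v \<in> proj ` {u. u \<noteq> 0 \<and> P u}"
  then obtain u where "u \<noteq> 0" "P u" "proj u = proj v" by force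
  then show "P v" using assms proj_eq_iff by metis
qed (use assms(1) in blast)

text \<open>
  An inequality between quadratic forms does not depend on the representative and so cuts out an
  open region of the projective plane.
\<close>

lemma proj_less_region:
  fixes g h :: "real \<times> real \<times> real \<Rightarrow> real"
  assumes cont: "continuous_on UNIV g" "continuous_on UNIV h"
    and hom: "\<And>c v. g (c *\<^sub>R v) = c\<^sup>2 * g v" "\<And>c v. h (c *\<^sub>R v) = c\<^sup>2 * h v"
  defines "R \<equiv> proj ` {v. v \<noteq> 0 \<and> g v < h v}"
  shows "v \<noteq> 0 \<Longrightarrow> proj v \<in> R \<longleftrightarrow> g v < h v" and "open R"
proof -
  show iff: "proj v \<in> R \<longleftrightarrow> g v < h v" if "v \<noteq> 0" for v
    unfolding R_def using hom by (intro proj_in_image_iff[OF that]) simp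
  have "{v. v \<noteq> 0 \<and> proj v \<in> R} = - {0} \<inter> {v. g v < h v}"
    using iff by blast
  then show "open R"
    unfolding open_proj_plane_def using cont by (simp add: open_Int open_Compl open_Collect_less)
qed

section \<open>A Moebius band around the component\<close>

text \<open>
  The distance to the curve is measured by \<open>|\<Phi>| / (x\<^sup>2 + y\<^sup>2)\<^sup>2\<close>. This quotient is homogeneous of
  degree zero, and its denominator does not involve \<open>z\<close>, which is the one coordinate of the map
  that depends on the parameter \<open>a\<close>. The inequality \<open>z\<^sup>2 \<le> x\<^sup>2 + y\<^sup>2\<close> keeps away from \<open>(0:0:1)\<close>, where
  the denominator vanishes, and from the small oval around this point that the curve also
  contains when \<open>k > 0\<close>. Radius \<open>0\<close> gives the component itself, and for radius \<open>5/4\<close> the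
  condition on \<open>\<Phi>\<close> is always satisfied.
\<close>

definition cassini_band :: "real \<Rightarrow> real \<Rightarrow> proj_plane set" where
  "cassini_band k r = proj ` {v. v \<noteq> 0 \<and> (case v of (x, y, z) \<Rightarrow>
     z\<^sup>2 \<le> x\<^sup>2 + y\<^sup>2 \<and> \<bar>cassini_poly k (x, y, z)\<bar> \<le> r * (x\<^sup>2 + y\<^sup>2)\<^sup>2)}"

lemma proj_in_cassini_band_iff:
  assumes "(x, y, z) \<noteq> 0"
  shows "proj (x, y, z) \<in> cassini_band k r \<longleftrightarrow>
    z\<^sup>2 \<le> x\<^sup>2 + y\<^sup>2 \<and> \<bar>cassini_poly k (x, y, z)\<bar> \<le> r * (x\<^sup>2 + y\<^sup>2)\<^sup>2"
proof -
  have "case c *\<^sub>R u of (x, y, z) \<Rightarrow>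
     z\<^sup>2 \<le> x\<^sup>2 + y\<^sup>2 \<and> \<bar>cassini_poly k (x, y, z)\<bar> \<le> r * (x\<^sup>2 + y\<^sup>2)\<^sup>2"
    if c: "c \<noteq> 0" and u: "case u of (x, y, z) \<Rightarrow>
     z\<^sup>2 \<le> x\<^sup>2 + y\<^sup>2 \<and> \<bar>cassini_poly k (x, y, z)\<bar> \<le> r * (x\<^sup>2 + y\<^sup>2)\<^sup>2" for c and u :: "real \<times> real \<times> real"
  proof -
    obtain x y z where [simp]: "u = (x, y, z)" by (cases u)
    have sq: "(c * x)\<^sup>2 + (c * y)\<^sup>2 = c\<^sup>2 * (x\<^sup>2 + y\<^sup>2)" by (simp add: algebra_simps)
    have poly: "cassini_poly k (c * x, c * y, c * z) = c ^ 4 * cassini_poly k (x, y, z)"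
      using cassini_poly_scale[of k c "(x, y, z)"] by simp
    have "(c * z)\<^sup>2 \<le> c\<^sup>2 * (x\<^sup>2 + y\<^sup>2)"
      using u by (simp add: power_mult_distrib mult_left_mono)
    moreover have "c ^ 4 * \<bar>cassini_poly k (x, y, z)\<bar> \<le> c ^ 4 * (r * (x\<^sup>2 + y\<^sup>2)\<^sup>2)"
      using u by (intro mult_left_mono) (auto simp del: cassini_poly.simps)
    ultimately show ?thesis
      by (simp add: sq poly abs_mult power_mult_distrib[of "c\<^sup>2"] mult_ac
          del: cassini_poly.simps flip: power_mult)
  qed
  then show ?thesis unfolding cassini_band_def
    by (subst proj_in_image_iff[OF assms]) auto
qed

lemma cassini_band_normalized:
  assumes "p \<in> cassini_band k r"
  obtains x y z where "p = proj (x, y, z)" "x\<^sup>2 + y\<^sup>2 = 1" "z\<^sup>2 \<le> 1"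
    "\<bar>cassini_poly k (x, y, z)\<bar> \<le> r"
proof -
  obtain x y z where p: "p = proj (x, y, z)" and nz: "(x, y, z) \<noteq> 0" by (rule proj_cases)
  have band: "z\<^sup>2 \<le> x\<^sup>2 + y\<^sup>2" using assms nz unfolding p by (simp add: proj_in_cassini_band_iff)
  define c where "c = 1 / sqrt (x\<^sup>2 + y\<^sup>2)"
  have pos: "x\<^sup>2 + y\<^sup>2 > 0"
  proof (rule ccontr)
    assume "\<not> x\<^sup>2 + y\<^sup>2 > 0"
    then have "x\<^sup>2 + y\<^sup>2 = 0" using sum_power2_ge_zero[of x y] by linarith
    with band nz show False by (simp add: zero_prod_def)
  qed
  have c: "c \<noteq> 0" and c2: "c\<^sup>2 * (x\<^sup>2 + y\<^sup>2) = 1"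
    using pos by (auto simp: c_def power_divide)
  have p': "p = proj (c * x, c * y, c * z)" using proj_scale[OF nz c] p by simp
  have nz': "(c * x, c * y, c * z) \<noteq> 0" using nz c by (auto simp: zero_prod_def)
  have one: "(c * x)\<^sup>2 + (c * y)\<^sup>2 = 1" using c2 by (simp add: algebra_simps)
  show thesis
    using assms unfolding p' proj_in_cassini_band_iff[OF nz'] one
    by (intro that[OF p' one]) auto
qed

lemma cassini_band_mono:
  assumes "r \<le> r'"
  shows "cassini_band k r \<subseteq> cassini_band k r'"
proof -
  have "r * t\<^sup>2 \<le> r' * t\<^sup>2" for t :: real using assms by (intro mult_right_mono) auto
  then show ?thesis
    unfolding cassini_band_def by (auto simp del: cassini_poly.simps intro: order_trans)
qed

lemma compact_cassini_band: "compact (cassini_band k r)"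
proof -
  define K where "K = {(x, y, z). x\<^sup>2 + y\<^sup>2 = 1 \<and> z\<^sup>2 \<le> 1 \<and> \<bar>cassini_poly k (x, y, z)\<bar> \<le> r}"
  have "cassini_band k r = proj ` K"
  proof (intro equalityI subsetI)
    fix p assume "p \<in> cassini_band k r"
    then show "p \<in> proj ` K" unfolding K_def by (rule cassini_band_normalized) auto
  next
    fix p assume "p \<in> proj ` K"
    then obtain x y z where "p = proj (x, y, z)" "x\<^sup>2 + y\<^sup>2 = 1" "z\<^sup>2 \<le> 1"
      "\<bar>cassini_poly k (x, y, z)\<bar> \<le> r" unfolding K_def by blast
    moreover from this(2) have "(x, y, z) \<noteq> 0" by (auto simp: zero_prod_def)
    ultimately show "p \<in> cassini_band k r" by (simp add: proj_in_cassini_band_iff)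
  qed
  moreover have "compact K"
  proof (rule compact_eq_bounded_closed[THEN iffD2], intro conjI)
    have "K \<subseteq> {- 1..1} \<times> {- 1..1} \<times> {- 1..1}"
    proof
      fix v assume "v \<in> K"
      then obtain x y z where v: "v = (x, y, z)" "x\<^sup>2 + y\<^sup>2 = 1" "z\<^sup>2 \<le> 1"
        unfolding K_def by auto
      then have "x\<^sup>2 \<le> 1" "y\<^sup>2 \<le> 1" using zero_le_power2[of x] zero_le_power2[of y] by linarith+
      with v show "v \<in> {- 1..1} \<times> {- 1..1} \<times> {- 1..1}" by (simp add: abs_square_le_1 abs_le_iff)
    qed
    then show "bounded K" by (rule bounded_subset[rotated]) (intro bounded_Times bounded_closed_interval)
    show "closed K"
      unfolding K_def cassini_poly.simps case_prod_unfold
      by (intro closed_Collect_conj closed_Collect_eq closed_Collect_le continuous_intros)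
  qed
  moreover have "K \<subseteq> - {0}" unfolding K_def by (auto simp: zero_prod_def)
  ultimately show ?thesis
    using compact_continuous_image continuous_on_subset[OF continuous_on_proj] by metis
qed

text \<open>
  Write \<open>W\<close> for the value of the third coordinate form at \<open>a = 0\<close>. Then
  \<open>\<Phi>(X, Y, W) = 16 k x\<^sup>2 y\<^sup>2 (x\<^sup>2 - y\<^sup>2)\<^sup>4 \<Phi>(x, y, z)\<close>. With \<open>x\<^sup>2 + y\<^sup>2 = 1\<close> one has
  \<open>(x\<^sup>2 - y\<^sup>2)\<^sup>4 = Y\<^sup>4 \<le> (X\<^sup>2 + Y\<^sup>2)\<^sup>2\<close> and \<open>4 x\<^sup>2 y\<^sup>2 \<le> 1\<close>, whence the contraction factor \<open>4 |k|\<close>.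
  Passing to \<open>Z = W - a \<Phi>\<close> changes \<open>\<Phi>(X, Y, W)\<close> by a multiple of \<open>a \<Phi>\<close>, with a bounded
  factor on the band; there \<open>X\<^sup>2 + Y\<^sup>2 \<ge> 1/4\<close>, so that the change adds at most
  \<open>72 |a|\<close> to the contraction factor.
  For the second claim, \<open>X\<^sup>2 + Y\<^sup>2\<close> exceeds \<open>W\<^sup>2\<close> by a constant, which leaves room for replacing
  \<open>W\<close> by \<open>Z\<close>.
\<close>

lemma cassini_form_estimates:
  fixes k a x y z :: real
  assumes k: "\<bar>k\<bar> < 1/4" and a: "\<bar>a\<bar> \<le> 1/72" and s: "x\<^sup>2 + y\<^sup>2 = 1" and z: "z\<^sup>2 \<le> 1"
  assumes form: "cassini_form k a (x, y, z) = (X, Y, Z)"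
  shows "X\<^sup>2 + Y\<^sup>2 > 0" "Z\<^sup>2 \<le> X\<^sup>2 + Y\<^sup>2"
    "\<bar>cassini_poly k (X, Y, Z)\<bar> \<le> (4 * \<bar>k\<bar> + 72 * \<bar>a\<bar>) * \<bar>cassini_poly k (x, y, z)\<bar> * (X\<^sup>2 + Y\<^sup>2)\<^sup>2"
proof -
  define p w P W S where "p = x\<^sup>2 * y\<^sup>2" and "w = z\<^sup>2" and "P = cassini_poly k (x, y, z)"
    and "W = 2 * x * y * (x\<^sup>2 - y\<^sup>2)" and "S = X\<^sup>2 + Y\<^sup>2"
  have X: "X = - 2 * x * y * (1 - 2 * k * w)" and Y: "Y = y\<^sup>2 - x\<^sup>2" and Z: "Z = W - a * P"
  proof -
    have "y ^ 4 - x ^ 4 = (y\<^sup>2 - x\<^sup>2) * (x\<^sup>2 + y\<^sup>2)" by (simp add: algebra_simps flip: power_add)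
    then show "Y = y\<^sup>2 - x\<^sup>2" using form s by simp
  qed (use form s in \<open>auto simp: w_def W_def P_def\<close>)
  have y2: "y\<^sup>2 = 1 - x\<^sup>2" using s by simp
  have D: "(y\<^sup>2 - x\<^sup>2)\<^sup>2 = 1 - 4 * p" unfolding p_def y2 by (simp add: power2_eq_square algebra_simps)
  have p: "0 \<le> p" "p \<le> 1/4" unfolding p_def using D zero_le_power2[of "y\<^sup>2 - x\<^sup>2"] by (auto simp: p_def)
  have w: "0 \<le> w" "w \<le> 1" using z by (auto simp: w_def)
  have kw: "\<bar>k * w\<bar> \<le> 1/4 * 1"
    unfolding abs_mult using k w by (intro mult_mono) auto
  have P_eq: "P = p - w + k * w\<^sup>2"
    unfolding P_def p_def w_def using s by (simp flip: power_mult)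
  have P_le: "\<bar>P\<bar> \<le> 5/4"
  proof -
    have "\<bar>k * w * w\<bar> \<le> 1/4 * 1" unfolding abs_mult[of "k * w"] using kw w by (intro mult_mono) auto
    then show ?thesis unfolding P_eq power2_eq_square mult.assoc[symmetric] using p w by linarith
  qed
  have aP: "\<bar>a * P\<bar> \<le> 1/72 * (5/4)" unfolding abs_mult using a P_le by (intro mult_mono) auto
  have Y2: "Y\<^sup>2 = 1 - 4 * p" unfolding Y by (rule D)
  have X2: "X\<^sup>2 = 4 * p * (1 - 2 * k * w)\<^sup>2" unfolding X p_def by (simp add: power_mult_distrib)
  have W2: "W\<^sup>2 = 4 * p * (1 - 4 * p)"
    unfolding D[symmetric] unfolding W_def p_def by (simp add: power_mult_distrib power2_commute)
  have factor: "1/4 \<le> (1 - 2 * k * w)\<^sup>2" "(1 - 2 * k * w)\<^sup>2 \<le> 9/4"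
    using power_mono[of "1/2" "1 - 2 * k * w" 2] power_mono[of "1 - 2 * k * w" "3/2" 2] kw
    by (auto simp: power2_eq_square abs_le_iff)
  have S_ge: "S \<ge> 1 - 3 * p" and S_le: "S \<le> 9/4" and S_D: "S \<ge> 1 - 4 * p"
    using mult_left_mono[OF factor(1), of "4 * p"] mult_left_mono[OF factor(2), of "4 * p"] p
    unfolding S_def X2 Y2 by auto
  have W_le: "\<bar>W\<bar> \<le> 1/2"
  proof -
    have "(1/2)\<^sup>2 - W\<^sup>2 = (1/2 - 4 * p)\<^sup>2" unfolding W2 by (simp add: power2_eq_square algebra_simps)
    then have "W\<^sup>2 \<le> (1/2)\<^sup>2" using zero_le_power2[of "1/2 - 4 * p"] by linarith
    then show ?thesis by (metis abs_le_square_iff abs_of_nonneg zero_le_divide_1_iff zero_le_numeral)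
  qed
  have Z_le: "\<bar>Z\<bar> \<le> 1" using W_le aP unfolding Z by linarith
  have ZW: "\<bar>Z + W\<bar> \<le> 3/2" using W_le Z_le by linarith
  have Z2: "Z\<^sup>2 - W\<^sup>2 = - (a * P) * (Z + W)" unfolding Z by (simp add: power2_eq_square algebra_simps)
  \<comment> \<open>Both sides are controlled by \<open>p\<close>: the difference \<open>1 - 3 p - 4 p (1 - 4 p)\<close> has minimum \<open>15/64\<close>,
    at \<open>p = 7/32\<close>.\<close>
  have S_gap: "S - W\<^sup>2 \<ge> 15/64"
  proof -
    have "1 - 3 * p - W\<^sup>2 - 15/64 = (4 * p - 7/8)\<^sup>2"
      unfolding W2 by (simp add: power2_eq_square algebra_simps)
    then show ?thesis using S_ge zero_le_power2[of "4 * p - 7/8"] by linarith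
  qed
  have "\<bar>Z\<^sup>2 - W\<^sup>2\<bar> \<le> (1/72 * (5/4)) * (3/2)"
    unfolding Z2 abs_mult[of "- (a * P)"] abs_minus_cancel using aP ZW by (intro mult_mono) auto
  then show "Z\<^sup>2 \<le> X\<^sup>2 + Y\<^sup>2" using S_gap unfolding S_def by linarith
  have S_pos: "S \<ge> 1/4" using S_ge p by linarith
  then show "X\<^sup>2 + Y\<^sup>2 > 0" unfolding S_def by linarith
  have unperturbed: "cassini_poly k (X, Y, W) = 16 * k * p * (1 - 4 * p)\<^sup>2 * P"
  proof -
    have "cassini_poly k (X, Y, W) = X\<^sup>2 * Y\<^sup>2 - (X\<^sup>2 + Y\<^sup>2) * W\<^sup>2 + k * (W\<^sup>2)\<^sup>2"
      by (simp flip: power_mult)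
    also have "\<dots> = 16 * k * p * (1 - 4 * p)\<^sup>2 * P"
      unfolding X2 Y2 W2 P_eq by (simp add: power2_eq_square algebra_simps)
    finally show ?thesis .
  qed
  have perturbation: "cassini_poly k (X, Y, Z) - cassini_poly k (X, Y, W)
      = - (a * P) * (Z + W) * (k * (Z\<^sup>2 + W\<^sup>2) - S)"
  proof -
    have "cassini_poly k (X, Y, Z) - cassini_poly k (X, Y, W) = (Z\<^sup>2 - W\<^sup>2) * (k * (Z\<^sup>2 + W\<^sup>2) - S)"
      unfolding S_def by (simp add: algebra_simps power2_eq_square eval_nat_numeral)
    then show ?thesis unfolding Z2 .
  qed
  have "\<bar>k * (Z\<^sup>2 + W\<^sup>2)\<bar> \<le> 1/4 * 2"
  proof -
    have "Z\<^sup>2 \<le> 1" "W\<^sup>2 \<le> 1" using Z_le W_le by (auto simp: abs_square_le_1)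
    then show ?thesis unfolding abs_mult using k by (intro mult_mono) auto
  qed
  then have third: "\<bar>k * (Z\<^sup>2 + W\<^sup>2) - S\<bar> \<le> 3" using S_le S_pos by linarith
  have S2: "1/16 \<le> S\<^sup>2" using power_mono[OF S_pos, of 2] by (simp add: power2_eq_square)
  have "\<bar>cassini_poly k (X, Y, Z) - cassini_poly k (X, Y, W)\<bar> \<le> \<bar>a * P\<bar> * (3/2) * 3"
    unfolding perturbation abs_mult[of "- (a * P) * (Z + W)"] abs_mult[of "- (a * P)"] abs_minus_cancel
    using ZW third by (intro mult_mono) auto
  \<comment> \<open>Here \<open>72 = 3/2 \<cdot> 3 \<cdot> 16\<close>, the last factor from \<open>S\<^sup>2 \<ge> 1/16\<close>.\<close>
  also have "\<dots> \<le> 72 * \<bar>a\<bar> * \<bar>P\<bar> * S\<^sup>2"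
    using mult_left_mono[OF S2, of "72 * \<bar>a\<bar> * \<bar>P\<bar>"] by (simp add: abs_mult)
  finally have 1: "\<bar>cassini_poly k (X, Y, Z) - cassini_poly k (X, Y, W)\<bar> \<le> 72 * \<bar>a\<bar> * \<bar>P\<bar> * S\<^sup>2" .
  have "(1 - 4 * p)\<^sup>2 \<le> S\<^sup>2" using S_D p by (intro power_mono) auto
  then have "(16 * p) * (1 - 4 * p)\<^sup>2 * (\<bar>k\<bar> * \<bar>P\<bar>) \<le> 4 * S\<^sup>2 * (\<bar>k\<bar> * \<bar>P\<bar>)"
    using p by (intro mult_mono) auto
  then have 2: "\<bar>cassini_poly k (X, Y, W)\<bar> \<le> 4 * \<bar>k\<bar> * \<bar>P\<bar> * S\<^sup>2"
    unfolding unperturbed abs_mult using p by (simp add: mult_ac)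
  show "\<bar>cassini_poly k (X, Y, Z)\<bar> \<le> (4 * \<bar>k\<bar> + 72 * \<bar>a\<bar>) * \<bar>cassini_poly k (x, y, z)\<bar> * (X\<^sup>2 + Y\<^sup>2)\<^sup>2"
    using 1 2 unfolding P_def[symmetric] S_def[symmetric] by (simp only: distrib_right) linarith
qed

lemma cassini_map_band:
  assumes k: "\<bar>k\<bar> < 1/4" and a: "\<bar>a\<bar> \<le> 1/72" and p: "p \<in> cassini_band k r"
  shows "p \<in> cassini_domain k a" "cassini_map k a p \<in> cassini_band k ((4 * \<bar>k\<bar> + 72 * \<bar>a\<bar>) * r)"
proof -
  obtain x y z where xyz: "p = proj (x, y, z)" "x\<^sup>2 + y\<^sup>2 = 1" "z\<^sup>2 \<le> 1"
    and r: "\<bar>cassini_poly k (x, y, z)\<bar> \<le> r" using p by (rule cassini_band_normalized)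
  obtain X Y Z where form: "cassini_form k a (x, y, z) = (X, Y, Z)" by (metis prod_cases3)
  note est = cassini_form_estimates[OF k a xyz(2,3) form]
  have nz: "(x, y, z) \<noteq> 0" "(X, Y, Z) \<noteq> 0" using xyz(2) est(1) by (auto simp: zero_prod_def)
  show "p \<in> cassini_domain k a" unfolding xyz(1) using nz form by (simp add: proj_in_cassini_domain_iff)
  have "(4 * \<bar>k\<bar> + 72 * \<bar>a\<bar>) * \<bar>cassini_poly k (x, y, z)\<bar> * (X\<^sup>2 + Y\<^sup>2)\<^sup>2
    \<le> (4 * \<bar>k\<bar> + 72 * \<bar>a\<bar>) * r * (X\<^sup>2 + Y\<^sup>2)\<^sup>2"
    using r by (intro mult_right_mono mult_left_mono) auto
  with est have "proj (X, Y, Z) \<in> cassini_band k ((4 * \<bar>k\<bar> + 72 * \<bar>a\<bar>) * r)"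
    unfolding proj_in_cassini_band_iff[OF nz(2)] by linarith
  then show "cassini_map k a p \<in> cassini_band k ((4 * \<bar>k\<bar> + 72 * \<bar>a\<bar>) * r)"
    unfolding xyz(1) using nz form by (simp only: cassini_map_proj not_False_eq_True)
qed

text \<open>
  On the band, \<open>x\<^sup>2 y\<^sup>2\<close>, \<open>s z\<^sup>2\<close> and \<open>|k| z\<^sup>4\<close> are at most \<open>s\<^sup>2/4\<close>, \<open>s\<^sup>2\<close> and \<open>s\<^sup>2/4\<close>, where
  \<open>s = x\<^sup>2 + y\<^sup>2\<close>. The first two enter \<open>\<Phi>\<close> with opposite signs.
\<close>

lemma cassini_band_of_z_le:
  assumes "(x, y, z) \<noteq> 0" "z\<^sup>2 \<le> x\<^sup>2 + y\<^sup>2" and k: "\<bar>k\<bar> < 1/4"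
  shows "proj (x, y, z) \<in> cassini_band k (5/4)"
proof -
  define s p where "s = x\<^sup>2 + y\<^sup>2" and "p = x\<^sup>2 * y\<^sup>2"
  have s2: "s\<^sup>2 = 4 * p + (x\<^sup>2 - y\<^sup>2)\<^sup>2" unfolding s_def p_def by (simp add: power2_eq_square algebra_simps)
  have p: "0 \<le> p" "4 * p \<le> s\<^sup>2" using s2 by (auto simp: p_def)
  have sz: "0 \<le> s * z\<^sup>2" "s * z\<^sup>2 \<le> s * s" using assms(2) by (auto simp: s_def intro!: mult_left_mono)
  have "z\<^sup>2 * z\<^sup>2 \<le> s * s" using assms(2) unfolding s_def by (intro mult_mono) auto
  then have "\<bar>k\<bar> * z ^ 4 \<le> 1/4 * s\<^sup>2"
    using k by (intro mult_mono) (auto simp flip: power_add simp: power2_eq_square[of s] power_even_eq)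
  then have "\<bar>k * z ^ 4\<bar> \<le> 1/4 * s\<^sup>2" by (simp add: abs_mult)
  then have "\<bar>p - s * z\<^sup>2 + k * z ^ 4\<bar> \<le> 5/4 * s\<^sup>2"
    using p sz unfolding power2_eq_square[of s] by linarith
  then show ?thesis
    using assms(2) unfolding proj_in_cassini_band_iff[OF assms(1)] cassini_poly.simps s_def p_def by simp
qed

section \<open>Uniformization of the component\<close>

text \<open>
  The boundary circle of the band misses the curve, since there
  \<open>\<Phi> = x\<^sup>2 y\<^sup>2 - (1 - k) (x\<^sup>2 + y\<^sup>2)\<^sup>2\<close> is negative. This separates the component of \<open>(0:1:0)\<close> from the
  rest of the curve and puts it in the interior of the band.
\<close>

lemma cassini_curve_off_circle:
  assumes k: "\<bar>k\<bar> < 1/4" and nz: "(x, y, z) \<noteq> 0" and "z\<^sup>2 = x\<^sup>2 + y\<^sup>2"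
  shows "cassini_poly k (x, y, z) \<noteq> 0"
proof
  assume zero: "cassini_poly k (x, y, z) = 0"
  have "x\<^sup>2 + y\<^sup>2 \<noteq> 0"
    using nz assms(3) by (auto simp: zero_prod_def)
  then have pos: "0 < (x\<^sup>2 + y\<^sup>2)\<^sup>2" by simp
  have "4 * cassini_poly k (x, y, z) = - 4 * (1 - k) * (x\<^sup>2 + y\<^sup>2)\<^sup>2 + 4 * x\<^sup>2 * y\<^sup>2"
  proof -
    have "z ^ 4 = (x\<^sup>2 + y\<^sup>2)\<^sup>2" unfolding assms(3)[symmetric] by (simp flip: power_mult)
    then show ?thesis unfolding cassini_poly.simps assms(3) by (simp add: algebra_simps power2_eq_square)
  qed
  also have "\<dots> = - (3 - 4 * k) * (x\<^sup>2 + y\<^sup>2)\<^sup>2 - (x\<^sup>2 - y\<^sup>2)\<^sup>2"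
    by (simp add: power2_eq_square algebra_simps)
  finally have "(3 - 4 * k) * (x\<^sup>2 + y\<^sup>2)\<^sup>2 + (x\<^sup>2 - y\<^sup>2)\<^sup>2 = 0" unfolding zero by (simp only: minus_mult_left[symmetric])
  moreover have "0 < (3 - 4 * k) * (x\<^sup>2 + y\<^sup>2)\<^sup>2" using k pos by (intro mult_pos_pos) auto
  ultimately show False using zero_le_power2[of "x\<^sup>2 - y\<^sup>2"] by linarith
qed

lemma cassini_band_0_subset_interior:
  assumes k: "\<bar>k\<bar> < 1/4"
  shows "cassini_band k 0 \<subseteq> interior (cassini_band k (5/4))"
proof
  fix p assume p: "p \<in> cassini_band k 0"
  define R where "R = proj ` {v. v \<noteq> 0 \<and> (case v of (x, y, z) \<Rightarrow> z\<^sup>2) < (case v of (x, y, z) \<Rightarrow> x\<^sup>2 + y\<^sup>2)}"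
  have "open R" unfolding R_def
    by (rule proj_less_region(2))
       (auto simp: case_prod_unfold power_mult_distrib distrib_left intro!: continuous_intros)
  moreover have "R \<subseteq> cassini_band k (5/4)"
    unfolding R_def using cassini_band_of_z_le[OF _ less_imp_le k] by auto
  moreover have "p \<in> R"
  proof -
    obtain x y z where p': "p = proj (x, y, z)" and nz: "(x, y, z) \<noteq> 0" by (rule proj_cases)
    then have "z\<^sup>2 < x\<^sup>2 + y\<^sup>2"
      using p cassini_curve_off_circle[OF k nz] by (auto simp: proj_in_cassini_band_iff order_le_less)
    with p' nz show ?thesis unfolding R_def by force
  qed
  ultimately show "p \<in> interior (cassini_band k (5/4))" by (meson interiorI)
qed

lemma cassini_component_subset_band:
  assumes k: "\<bar>k\<bar> < 1/4"
  shows "cassini_component k \<subseteq> cassini_band k 0"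
proof -
  define C where "C = cassini_component k"
  define A B where "A = proj ` {v. v \<noteq> 0 \<and> (case v of (x, y, z) \<Rightarrow> z\<^sup>2) < (case v of (x, y, z) \<Rightarrow> x\<^sup>2 + y\<^sup>2)}"
    and "B = proj ` {v. v \<noteq> 0 \<and> (case v of (x, y, z) \<Rightarrow> x\<^sup>2 + y\<^sup>2) < (case v of (x, y, z) \<Rightarrow> z\<^sup>2)}"
  note forms = case_prod_unfold power_mult_distrib distrib_left
  have openA: "open A" and openB: "open B"
    unfolding A_def B_def
    by (rule proj_less_region(2); auto simp: forms intro!: continuous_intros)+
  have A_iff: "proj (x, y, z) \<in> A \<longleftrightarrow> z\<^sup>2 < x\<^sup>2 + y\<^sup>2"
    and B_iff: "proj (x, y, z) \<in> B \<longleftrightarrow> x\<^sup>2 + y\<^sup>2 < z\<^sup>2" if "(x, y, z) \<noteq> 0" for x y z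
    unfolding A_def B_def
    by (subst proj_less_region(1)[OF _ _ _ _ that]; auto simp: forms intro!: continuous_intros)+
  have nz0: "(0 :: real, 1 :: real, 0 :: real) \<noteq> 0" by (simp add: zero_prod_def)
  have base: "proj (0, 1, 0) \<in> cassini_curve k" by (simp add: proj_in_cassini_curve_iff[OF nz0])
  have C_curve: "C \<subseteq> cassini_curve k"
    unfolding C_def cassini_component_def by (rule connected_component_subset)
  have "connected C" unfolding C_def cassini_component_def by (rule connected_connected_component)
  moreover have "A \<inter> B \<inter> C = {}"
  proof (rule equals0I)
    fix p assume p: "p \<in> A \<inter> B \<inter> C"
    obtain x y z where "p = proj (x, y, z)" "(x, y, z) \<noteq> 0" by (rule proj_cases)
    then show False using p A_iff B_iff by (metis IntD1 IntD2 order_less_asym)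
  qed
  moreover have "C \<subseteq> A \<union> B"
  proof
    fix p assume "p \<in> C"
    then have p: "p \<in> cassini_curve k" using C_curve by blast
    obtain x y z where p': "p = proj (x, y, z)" and nz: "(x, y, z) \<noteq> 0" by (rule proj_cases)
    then have "z\<^sup>2 \<noteq> x\<^sup>2 + y\<^sup>2"
      using p cassini_curve_off_circle[OF k nz] by (metis proj_in_cassini_curve_iff)
    then show "p \<in> A \<union> B" unfolding p' Un_iff A_iff[OF nz] B_iff[OF nz] by linarith
  qed
  moreover have "proj (0, 1, 0) \<in> A \<inter> C"
    unfolding Int_iff A_iff[OF nz0] unfolding C_def cassini_component_def
    using base by (simp add: connected_component_refl)
  ultimately have "B \<inter> C = {}" using connectedD[of C A B] openA openB by blast
  show ?thesis unfolding C_def[symmetric]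
  proof
    fix p assume "p \<in> C"
    then have p: "p \<in> cassini_curve k" "p \<notin> B" using C_curve \<open>B \<inter> C = {}\<close> by blast+
    obtain x y z where p': "p = proj (x, y, z)" and nz: "(x, y, z) \<noteq> 0" by (rule proj_cases)
    with p show "p \<in> cassini_band k 0"
      unfolding p' proj_in_cassini_band_iff[OF nz] proj_in_cassini_curve_iff[OF nz] B_iff[OF nz]
      by simp
  qed
qed

text \<open>
  The birational change of coordinates \<open>(s, c) = (z/y, z/x)\<close> turns the Cassini quartic into the
  Edwards curve \<open>s\<^sup>2 + c\<^sup>2 = 1 + k s\<^sup>2 c\<^sup>2\<close>, with inverse \<open>(s, c) \<mapsto> (s : c : s c)\<close>. Equivalently
  \<open>(x\<^sup>2 - z\<^sup>2) (y\<^sup>2 - z\<^sup>2) = (1 - k) z\<^sup>4\<close>, so \<open>|s|\<close> and \<open>|c|\<close> are both less than \<open>1\<close> or both greater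
  than \<open>1\<close>, and the second case is excluded on the band. At \<open>z = 0\<close> the curve has only its
  two nodes, which correspond to \<open>(0, 1)\<close> and \<open>(1, 0)\<close>.
\<close>

lemma cassini_band_0_coordinates:
  assumes k: "\<bar>k\<bar> < 1/4" and p: "p \<in> cassini_band k 0"
  obtains s c where "\<bar>s\<bar> \<le> 1" "s\<^sup>2 + c\<^sup>2 = 1 + k * s\<^sup>2 * c\<^sup>2" "p = proj (s, c, s * c)"
proof -
  obtain x y z where xyz: "p = proj (x, y, z)" "x\<^sup>2 + y\<^sup>2 = 1" "z\<^sup>2 \<le> 1"
    and zero: "cassini_poly k (x, y, z) = 0"
    using p by (rule cassini_band_normalized) auto
  have nz: "(x, y, z) \<noteq> 0" using xyz(2) by (auto simp: zero_prod_def)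
  have eq: "x\<^sup>2 * y\<^sup>2 = z\<^sup>2 * (1 - k * z\<^sup>2)"
    using zero xyz(2) by (simp add: algebra_simps flip: power_add)
  have kz: "\<bar>k * z\<^sup>2\<bar> \<le> 1/4 * 1" unfolding abs_mult using k xyz(3) by (intro mult_mono) auto
  show thesis
  proof (cases "z = 0")
    case True
    then consider "x = 0" | "y = 0" using eq by auto
    then show thesis
    proof cases
      case 1
      then have "p = proj (y *\<^sub>R (0, 1, 0))" "y \<noteq> 0" using xyz True by auto
      then have "p = proj (0, 1, 0 * 1)" by (subst (asm) proj_scale) (auto simp: zero_prod_def)
      then show thesis by (intro that[of 0 1]) auto
    next
      case 2
      then have "p = proj (x *\<^sub>R (1, 0, 0))" "x \<noteq> 0" using xyz True by auto
      then have "p = proj (1, 0, 1 * 0)" by (subst (asm) proj_scale) (auto simp: zero_prod_def)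
      then show thesis by (intro that[of 1 0]) auto
    qed
  next
    case False
    then have z2: "z\<^sup>2 > 0" by simp
    have "x\<^sup>2 * y\<^sup>2 > 0" unfolding eq using z2 kz by (intro mult_pos_pos) auto
    then have xy: "x \<noteq> 0" "y \<noteq> 0" by auto
    have "z\<^sup>2 \<le> y\<^sup>2"
    proof (rule ccontr)
      assume less: "\<not> z\<^sup>2 \<le> y\<^sup>2"
      have "(z\<^sup>2 - x\<^sup>2) * (z\<^sup>2 - y\<^sup>2) = x\<^sup>2 * y\<^sup>2 - z\<^sup>2 * (x\<^sup>2 + y\<^sup>2) + z\<^sup>2 * z\<^sup>2"
        by (simp add: algebra_simps)
      also have "\<dots> = (1 - k) * (z\<^sup>2 * z\<^sup>2)" unfolding xyz(2) eq by (simp add: algebra_simps)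
      finally have "(z\<^sup>2 - x\<^sup>2) * (z\<^sup>2 - y\<^sup>2) > 0" using k z2 by simp
      then have "x\<^sup>2 < z\<^sup>2" using less by (simp add: zero_less_mult_iff)
      \<comment> \<open>Both squares are less than \<open>z\<^sup>2\<close>, and the smaller one is at most \<open>1/2\<close>.\<close>
      have "x\<^sup>2 * y\<^sup>2 \<le> z\<^sup>2 * (1/2)"
      proof (cases "x\<^sup>2 \<le> 1/2")
        case True
        then have "y\<^sup>2 * x\<^sup>2 \<le> z\<^sup>2 * (1/2)" using less by (intro mult_mono) auto
        then show ?thesis by (simp add: mult.commute)
      next
        case False
        then show ?thesis using \<open>x\<^sup>2 < z\<^sup>2\<close> xyz(2) by (intro mult_mono) auto
      qed
      moreover have "z\<^sup>2 * (3/4) \<le> x\<^sup>2 * y\<^sup>2" unfolding eq using kz by (intro mult_left_mono) auto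
      ultimately show False using z2 by linarith
    qed
    then have "\<bar>z / y\<bar> \<le> 1" using xy by (simp add: abs_divide abs_le_square_iff)
    moreover have "(z / y)\<^sup>2 + (z / x)\<^sup>2 = 1 + k * (z / y)\<^sup>2 * (z / x)\<^sup>2"
    proof -
      have "(z / y)\<^sup>2 + (z / x)\<^sup>2 = z\<^sup>2 * (x\<^sup>2 + y\<^sup>2) / (x\<^sup>2 * y\<^sup>2)"
        using xy by (simp add: power_divide field_simps)
      moreover have "1 + k * (z / y)\<^sup>2 * (z / x)\<^sup>2 = (x\<^sup>2 * y\<^sup>2 + k * z\<^sup>2 * z\<^sup>2) / (x\<^sup>2 * y\<^sup>2)"
        using xy by (simp add: power_divide field_simps)
      moreover have "z\<^sup>2 * (x\<^sup>2 + y\<^sup>2) = x\<^sup>2 * y\<^sup>2 + k * z\<^sup>2 * z\<^sup>2"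
        unfolding xyz(2) eq by (simp add: algebra_simps)
      ultimately show ?thesis by simp
    qed
    moreover have "p = proj (z / y, z / x, z / y * (z / x))"
    proof -
      have "(z / y, z / x, z / y * (z / x)) = (z / (x * y)) *\<^sub>R (x, y, z)"
        using xy by simp
      moreover have "z / (x * y) \<noteq> 0" using False xy by simp
      ultimately show ?thesis using proj_scale[OF nz] xyz(1) by metis
    qed
    ultimately show thesis by (rule that)
  qed
qed

text \<open>
  In Edwards coordinates the map is the negative \<open>(s, c) \<mapsto> (- s, c)\<close> of the doubling of a point,
  whatever the value of \<open>a\<close>.
\<close>

lemma cassini_map_edwards:
  assumes curve: "s\<^sup>2 + c\<^sup>2 = 1 + k * s\<^sup>2 * c\<^sup>2"
    and nz: "1 + k * s\<^sup>2 * c\<^sup>2 \<noteq> 0" "1 - k * s\<^sup>2 * c\<^sup>2 \<noteq> 0"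
    and s': "s' = - 2 * s * c / (1 + k * s\<^sup>2 * c\<^sup>2)" and c': "c' = (c\<^sup>2 - s\<^sup>2) / (1 - k * s\<^sup>2 * c\<^sup>2)"
    and nz': "(s', c') \<noteq> 0"
  shows "cassini_map k a (proj (s, c, s * c)) = proj (s', c', s' * c')"
proof -
  define P where "P = k * s\<^sup>2 * c\<^sup>2"
  have cp: "1 + P \<noteq> 0" "1 - P \<noteq> 0" using nz by (auto simp: P_def)
  have sc: "s\<^sup>2 + c\<^sup>2 = 1 + P" using curve by (simp add: P_def)
  have nz0: "(s, c, s * c) \<noteq> 0" using nz' unfolding s' c' by (auto simp: zero_prod_def)
  have poly: "cassini_poly k (s, c, s * c) = 0"
  proof -
    have "cassini_poly k (s, c, s * c) = s\<^sup>2 * c\<^sup>2 * (1 + k * s\<^sup>2 * c\<^sup>2 - (s\<^sup>2 + c\<^sup>2))"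
      by (simp add: algebra_simps power2_eq_square eval_nat_numeral)
    then show ?thesis using curve by simp
  qed
  have s'': "(1 + P) * s' = - 2 * s * c" and c'': "(1 - P) * c' = c\<^sup>2 - s\<^sup>2"
    using cp unfolding s' c' P_def[symmetric] by simp_all
  have "- 2 * s * c * (s\<^sup>2 + c\<^sup>2 - 2 * k * (s * c)\<^sup>2) = - 2 * s * c * (1 - P)"
    unfolding sc by (simp add: P_def power_mult_distrib)
  also have "\<dots> = (1 + P) * (1 - P) * s'" unfolding s''[symmetric] by simp
  finally have 1: "- 2 * s * c * (s\<^sup>2 + c\<^sup>2 - 2 * k * (s * c)\<^sup>2) = (1 + P) * (1 - P) * s'" .
  have "c ^ 4 - s ^ 4 = (c\<^sup>2 - s\<^sup>2) * (s\<^sup>2 + c\<^sup>2)" by (simp add: algebra_simps flip: power_add)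
  also have "\<dots> = (1 + P) * (1 - P) * c'" unfolding sc c''[symmetric] by simp
  finally have 2: "c ^ 4 - s ^ 4 = (1 + P) * (1 - P) * c'" .
  have "2 * s * c * (s\<^sup>2 - c\<^sup>2) = (- 2 * s * c) * (c\<^sup>2 - s\<^sup>2)" by (simp add: algebra_simps)
  also have "\<dots> = (1 + P) * (1 - P) * (s' * c')" unfolding c''[symmetric] s''[symmetric] by simp
  finally have 3: "2 * s * c * (s\<^sup>2 - c\<^sup>2) = (1 + P) * (1 - P) * (s' * c')" .
  have form: "cassini_form k a (s, c, s * c) = ((1 + P) * (1 - P)) *\<^sub>R (s', c', s' * c')"
    unfolding cassini_form.simps poly 1 2 3 by simp
  have nz'': "(s', c', s' * c') \<noteq> 0" using nz' by (auto simp: zero_prod_def)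
  have "cassini_form k a (s, c, s * c) \<noteq> 0" unfolding form using nz'' cp by (simp add: zero_prod_def)
  then have "cassini_map k a (proj (s, c, s * c)) = proj (((1 + P) * (1 - P)) *\<^sub>R (s', c', s' * c'))"
    using cassini_map_proj[OF nz0] form by metis
  also have "\<dots> = proj (s', c', s' * c')" using nz'' cp by (intro proj_scale) auto
  finally show ?thesis .
qed

text \<open>
  Since the map is minus doubling in Edwards coordinates, and \<open>sn\<close> is odd and \<open>cd\<close> even, the
  Jacobi functions conjugate it to multiplication by \<open>-2\<close>. Continuity of the parametrization shows
  that its image is connected, hence contained in the component; the band contains the component
  and is covered by the parametrization.
\<close>

lemma cassini_component_uniformization:
  assumes k: "\<bar>k\<bar> < 1/4"
  obtains \<gamma> :: "real \<Rightarrow> proj_plane" and L where "L > 0" "continuous_on UNIV \<gamma>" "\<And>u. \<gamma> (u + L) = \<gamma> u"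
    "range \<gamma> = cassini_component k" "cassini_component k = cassini_band k 0"
    "\<And>a u. cassini_map k a (\<gamma> u) = \<gamma> (- 2 * u)"
proof (rule jacobi_sn_cd[OF k])
  fix sn cd :: "real \<Rightarrow> real" and L
  assume L: "L > 0"
    and sn: "\<And>u. (sn has_real_derivative cd u * (1 - k * (sn u)\<^sup>2)) (at u)"
    and cd: "\<And>u. (cd has_real_derivative - (sn u * (1 - k * (cd u)\<^sup>2))) (at u)"
    and curve: "\<And>u. (sn u)\<^sup>2 + (cd u)\<^sup>2 = 1 + k * (sn u)\<^sup>2 * (cd u)\<^sup>2"
    and le: "\<And>u. \<bar>sn u\<bar> \<le> 1" "\<And>u. \<bar>cd u\<bar> \<le> 1" and at_0: "sn 0 = 0" "cd 0 = 1"
    and per: "\<And>u. sn (u + L) = sn u" "\<And>u. cd (u + L) = cd u"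
    and sym: "\<And>u. sn (- u) = - sn u" "\<And>u. cd (- u) = cd u"
    and surj: "\<And>x y. \<bar>x\<bar> \<le> 1 \<Longrightarrow> x\<^sup>2 + y\<^sup>2 = 1 + k * x\<^sup>2 * y\<^sup>2 \<Longrightarrow> \<exists>u. sn u = x \<and> cd u = y"
  define \<gamma> where "\<gamma> u = proj (sn u, cd u, sn u * cd u)" for u
  have nz: "(sn u, cd u) \<noteq> 0" for u using curve[of u] by (auto simp: zero_prod_def)
  then have nz3: "(sn u, cd u, sn u * cd u) \<noteq> 0" for u by (auto simp: zero_prod_def)
  have cont: "continuous_on UNIV \<gamma>"
    unfolding \<gamma>_def[abs_def]
  proof (rule continuous_on_compose2[OF continuous_on_proj])
    have "continuous_on UNIV sn" "continuous_on UNIV cd"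
      using sn cd by (meson DERIV_isCont continuous_at_imp_continuous_on)+
    then show "continuous_on UNIV (\<lambda>u. (sn u, cd u, sn u * cd u))" by (intro continuous_intros)
  qed (use nz3 in auto)
  have range: "range \<gamma> = cassini_band k 0"
  proof (intro equalityI subsetI)
    fix p assume "p \<in> range \<gamma>"
    then obtain u where p: "p = \<gamma> u" by blast
    have "cassini_poly k (sn u, cd u, sn u * cd u)
      = (sn u)\<^sup>2 * (cd u)\<^sup>2 * (1 + k * (sn u)\<^sup>2 * (cd u)\<^sup>2 - ((sn u)\<^sup>2 + (cd u)\<^sup>2))"
      by (simp add: algebra_simps power2_eq_square eval_nat_numeral)
    also have "\<dots> = 0" unfolding curve by simp
    finally have "cassini_poly k (sn u, cd u, sn u * cd u) = 0" .
    moreover have "(sn u * cd u)\<^sup>2 \<le> (sn u)\<^sup>2 * 1"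
      unfolding power_mult_distrib using le(2)[of u] by (intro mult_left_mono) (auto simp: abs_square_le_1)
    then have "(sn u * cd u)\<^sup>2 \<le> (sn u)\<^sup>2 + (cd u)\<^sup>2" using zero_le_power2[of "cd u"] by linarith
    ultimately show "p \<in> cassini_band k 0"
      unfolding p \<gamma>_def proj_in_cassini_band_iff[OF nz3] by simp
  next
    fix p assume "p \<in> cassini_band k 0"
    then obtain s c where "\<bar>s\<bar> \<le> 1" "s\<^sup>2 + c\<^sup>2 = 1 + k * s\<^sup>2 * c\<^sup>2" "p = proj (s, c, s * c)"
      using cassini_band_0_coordinates[OF k] by metis
    then show "p \<in> range \<gamma>" using surj unfolding \<gamma>_def by blast
  qed
  have comp: "range \<gamma> = cassini_component k"
  proof
    show "range \<gamma> \<subseteq> cassini_component k"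
      unfolding cassini_component_def
    proof (rule connected_component_maximal)
      show "connected (range \<gamma>)" using cont by (intro connected_continuous_image) auto
      show "proj (0, 1, 0) \<in> range \<gamma>" by (rule range_eqI[of _ _ 0]) (simp add: \<gamma>_def at_0)
      show "range \<gamma> \<subseteq> cassini_curve k"
      proof
        fix p assume p: "p \<in> range \<gamma>"
        then obtain u where "p = \<gamma> u" by blast
        with p show "p \<in> cassini_curve k"
          unfolding range \<gamma>_def using nz3[of u]
          by (simp add: proj_in_cassini_band_iff proj_in_cassini_curve_iff del: cassini_poly.simps)
      qed
    qed
  qed (use cassini_component_subset_band[OF k] range in simp)
  have dyn: "cassini_map k a (\<gamma> u) = \<gamma> (- 2 * u)" for a u
    unfolding \<gamma>_def
  proof (rule cassini_map_edwards[OF curve])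
    show "1 + k * (sn u)\<^sup>2 * (cd u)\<^sup>2 \<noteq> 0" "1 - k * (sn u)\<^sup>2 * (cd u)\<^sup>2 \<noteq> 0"
      using edwards_denominators_pos[OF k le(1)[of u] le(1)[of u] le(2)[of u] le(2)[of u]]
      by (simp_all add: power2_eq_square mult.assoc)
    note doubling = edwards_doubling[OF k sn cd curve le at_0, of u]
    show "sn (- 2 * u) = - 2 * sn u * cd u / (1 + k * (sn u)\<^sup>2 * (cd u)\<^sup>2)"
      using sym(1)[of "2 * u"] doubling(1) by simp
    show "cd (- 2 * u) = ((cd u)\<^sup>2 - (sn u)\<^sup>2) / (1 - k * (sn u)\<^sup>2 * (cd u)\<^sup>2)"
      using sym(2)[of "2 * u"] doubling(2) by simp
    show "(sn (- 2 * u), cd (- 2 * u)) \<noteq> 0" by (rule nz)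
  qed
  show thesis
    by (rule that[OF L cont _ comp _ dyn]) (use comp range in \<open>auto simp: \<gamma>_def per\<close>)
qed

section \<open>The component is a trapped attractor\<close>

theorem theorem7p2:
  fixes k :: real
  assumes "0 < \<bar>k\<bar>" and "\<bar>k\<bar> < 1/4"
  shows "\<exists>a0>0. \<forall>a::real. \<bar>a\<bar> < a0 \<longrightarrow>
           trapped_attractor (cassini_domain k a) (cassini_map k a) (cassini_component k)"
proof (intro exI[of _ "(1 - 4 * \<bar>k\<bar>) / 72"] conjI allI impI)
  note k = assms(2)
  show "(1 - 4 * \<bar>k\<bar>) / 72 > 0" using k by simp
  fix a :: real assume a: "\<bar>a\<bar> < (1 - 4 * \<bar>k\<bar>) / 72"
  define A f q where "A = cassini_component k" and "f = cassini_map k a"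
    and "q = 4 * \<bar>k\<bar> + 72 * \<bar>a\<bar>"
  have a': "\<bar>a\<bar> \<le> 1/72" and q: "0 \<le> q" "q < 1" using a unfolding q_def by auto
  obtain \<gamma> :: "real \<Rightarrow> proj_plane" and L where L: "L > 0" and cont: "continuous_on UNIV \<gamma>" and per: "\<And>u. \<gamma> (u + L) = \<gamma> u"
    and range: "range \<gamma> = A" and A_band: "A = cassini_band k 0"
    and dyn: "\<And>u. f (\<gamma> u) = \<gamma> (- 2 * u)"
    using cassini_component_uniformization[OF k] unfolding A_def f_def by metis
  have fA: "f ` A = A"
  proof
    show "f ` A \<subseteq> A" unfolding range[symmetric] by (auto simp: dyn)
    have "\<gamma> u = f (\<gamma> (- u / 2))" for u by (simp add: dyn)
    then show "A \<subseteq> f ` A" unfolding range[symmetric] by blast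
  qed
  have fnA: "(f ^^ n) ` A = A" for n
  proof (induction n)
    case (Suc n)
    have "(f ^^ Suc n) ` A = f ` (f ^^ n) ` A" by (simp add: image_comp)
    then show ?case using Suc fA by simp
  qed simp
  define N where "N = cassini_band k (5/4)"
  have A_N: "A \<subseteq> interior N"
    unfolding A_band N_def by (rule cassini_band_0_subset_interior[OF k])
  have fN: "f ` N \<subseteq> N"
  proof (intro subsetI; elim imageE)
    fix p p' assume p: "p' = f p" "p \<in> N"
    then have "p' \<in> cassini_band k (q * (5/4))"
      using cassini_map_band(2)[OF k a'] unfolding N_def f_def q_def by blast
    moreover have "q * (5/4) \<le> 5/4" using q by simp
    ultimately show "p' \<in> N" unfolding N_def using cassini_band_mono by blast
  qed
  \<comment> \<open>The bands shrink geometrically; their intersection is the band of radius \<open>0\<close>.\<close>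
  have fnN: "(f ^^ n) ` N \<subseteq> cassini_band k (q ^ n * (5/4))" for n
  proof (induction n)
    case (Suc n)
    have "f p \<in> cassini_band k (q ^ Suc n * (5/4))" if "p \<in> cassini_band k (q ^ n * (5/4))" for p
      using cassini_map_band(2)[OF k a' that] unfolding f_def q_def by (simp add: mult.assoc)
    then show ?case using Suc by auto
  qed (simp add: N_def)
  have Inter: "A = (\<Inter>n. (f ^^ n) ` N)"
  proof (intro equalityI subsetI INT_I)
    fix p n assume "p \<in> A"
    then show "p \<in> (f ^^ n) ` N" using fnA A_N interior_subset by blast
  next
    fix p assume "p \<in> (\<Inter>n. (f ^^ n) ` N)"
    then have p: "p \<in> cassini_band k (q ^ n * (5/4))" for n using fnN by blast
    obtain x y z where p': "p = proj (x, y, z)" and nz: "(x, y, z) \<noteq> 0" by (rule proj_cases)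
    have bound: "z\<^sup>2 \<le> x\<^sup>2 + y\<^sup>2"
      "\<bar>cassini_poly k (x, y, z)\<bar> \<le> q ^ n * (5/4) * (x\<^sup>2 + y\<^sup>2)\<^sup>2" for n
      using p[of n] unfolding p' proj_in_cassini_band_iff[OF nz] by auto
    have "(\<lambda>n. q ^ n * (5/4) * (x\<^sup>2 + y\<^sup>2)\<^sup>2) \<longlonglongrightarrow> 0 * (5/4) * (x\<^sup>2 + y\<^sup>2)\<^sup>2"
      using q by (intro tendsto_intros LIMSEQ_power_zero) auto
    then have "\<bar>cassini_poly k (x, y, z)\<bar> \<le> 0 * (5/4) * (x\<^sup>2 + y\<^sup>2)\<^sup>2"
      by (rule LIMSEQ_le_const) (use bound(2) in blast)
    then show "p \<in> A" unfolding A_band p' proj_in_cassini_band_iff[OF nz] using bound(1) by simp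
  qed
  have "trapped_attracting_set (cassini_domain k a) f A"
    unfolding trapped_attracting_set_def compact_trapping_neighborhood_def
  proof (intro conjI exI[of _ N])
    show "compact A" unfolding A_band by (rule compact_cassini_band)
    show "compact N" unfolding N_def by (rule compact_cassini_band)
    show "N \<subseteq> cassini_domain k a" using cassini_map_band(1)[OF k a'] unfolding N_def by blast
  qed (use fA A_N fN Inter in auto)
  moreover have "\<exists>p\<in>A. range (\<lambda>n. (f ^^ n) p) \<subseteq> A \<and> A \<subseteq> closure (range (\<lambda>n. (f ^^ n) p))"
  proof -
    obtain t where t: "\<And>p q. p < q \<Longrightarrow> \<exists>n m. p < (- 2) ^ n * t + of_int m * L \<and> (- 2) ^ n * t + of_int m * L < q"
      using dense_orbit_times_minus_two[OF L] by blast
    have iter: "(f ^^ n) (\<gamma> t) = \<gamma> ((- 2) ^ n * t)" for n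
      by (induction n) (simp_all add: dyn mult.assoc)
    have per_nat: "\<gamma> (u + of_nat m * L) = \<gamma> u" for u m
    proof (induction m)
      case (Suc m)
      then show ?case using per[of "u + of_nat m * L"] by (simp add: algebra_simps)
    qed simp
    have per_int: "\<gamma> (u + of_int m * L) = \<gamma> u" for u m
    proof (cases m rule: int_cases2)
      case (nonneg n)
      then show ?thesis using per_nat by simp
    next
      case (nonpos n)
      then show ?thesis using per_nat[of "u + of_int m * L" n] by simp
    qed
    \<comment> \<open>A neighborhood of \<open>\<gamma> u\<close> pulls back to a neighborhood of \<open>u\<close>, which the orbit of \<open>t\<close> meets
      modulo \<open>L\<close>.\<close>
    have "\<gamma> u \<in> closure (range (\<lambda>n. (f ^^ n) (\<gamma> t)))" for u
      unfolding closure_iff_nhds_not_empty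
    proof (intro allI impI)
      fix S U assume U: "U \<subseteq> S" "open U" "\<gamma> u \<in> U"
      have "open (\<gamma> -` U)" using cont U(2) by (simp add: open_vimage)
      then obtain e where e: "e > 0" "ball u e \<subseteq> \<gamma> -` U" using U(3) openE by blast
      obtain n m where nm: "u < (- 2) ^ n * t + of_int m * L" "(- 2) ^ n * t + of_int m * L < u + e"
        using t[of u "u + e"] e(1) by auto
      then have "(- 2) ^ n * t + of_int m * L \<in> ball u e" by (simp add: dist_real_def)
      then have "(f ^^ n) (\<gamma> t) \<in> U" using e(2) by (auto simp: iter per_int)
      then show "range (\<lambda>n. (f ^^ n) (\<gamma> t)) \<inter> S \<noteq> {}" using U(1) by blast
    qed
    then have "A \<subseteq> closure (range (\<lambda>n. (f ^^ n) (\<gamma> t)))" unfolding range[symmetric] by blast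
    moreover have "range (\<lambda>n. (f ^^ n) (\<gamma> t)) \<subseteq> A" unfolding range[symmetric] by (auto simp: iter)
    moreover have "\<gamma> t \<in> A" using range by blast
    ultimately show ?thesis by blast
  qed
  ultimately show "trapped_attractor (cassini_domain k a) (cassini_map k a) (cassini_component k)"
    unfolding trapped_attractor_def A_def f_def by blast
qed

end
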